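(* Let $\ell<\infty$ and let $\mu$ be a probability measure on $[-\ell,\ell]$. For each $n$, let $X=\{x_{i,j}\}$ be a random real symmetric $n\times n$ matrix whose entries $x_{i,j}$, $j\ge i$, are independent with common distribution $\mu$, let $k(x,y)=\sum_{i,j=1}^n x_{i,j}\mathbf 1_{J^n_i}(x)\mathbf 1_{J^n_j}(y)$ with $J^n_i=[\frac{i-1}{n},\frac in]$, and let $\tilde Q_n$ be the law of the orbit $\tilde k\in\tilde{\mathcal K}$. Then for every $\tilde f\in\tilde{\mathcal K}$, $$\limsup_{\epsilon\to0}\limsup_{n\to\infty}\frac1{n^2}\log\tilde Q_n\big[\tilde k:\tilde d_\square(\tilde k,\tilde f)<\epsilon\big]\le -I(\tilde f).$$
   Context: $M(\theta)=\int e^{\theta x}\mu(dx)$, $h(x)=\sup_\theta[\theta x-\log M(\theta)]$. $\mathcal{K}$ is the space of measurable symmetric kernels $k$ on $D=[0,1]^2$ with $\int_D k^2<\infty$, and $I(k)=\frac12\int_D h(k(x,y))\,dxdy$. The cut distance is $d_\square(k_1,k_2)=\sup_{A,B}\left|\int_{A\times B}(k_1-k_2)\,dxdy\right|$ over Borel $A,B\subset[0,1]$. $G$ is the group of measure-preserving bijections of $[0,1]$, acting by $(\sigma k)(x,y)=k(\sigma x,\sigma y)$; $\tilde{\mathcal K}=\mathcal K/G$ with $\tilde d_\square(\tilde k_1,\tilde k_2)=\inf_{\sigma\in G}d_\square(\sigma k_1,k_2)$, and $I(\tilde f)=I(f)$ for any representative $f$. *)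

theory Defs
  imports "HOL-Probability.Probability"
begin

definition Dsq :: "(real \<times> real) set" where
  "Dsq = {0..1} \<times> {0..1}"

definition kernel_space :: "(real \<times> real \<Rightarrow> real) set" where
  "kernel_space = {k. set_borel_measurable lborel Dsq k
      \<and> (\<forall>x\<in>{0..1}. \<forall>y\<in>{0..1}. k (x, y) = k (y, x))
      \<and> set_integrable lborel Dsq (\<lambda>z. (k z)^2)}"

definition cut_dist :: "(real \<times> real \<Rightarrow> real) \<Rightarrow> (real \<times> real \<Rightarrow> real) \<Rightarrow> real" where
  "cut_dist k1 k2 = (SUP AB \<in> {(A, B). A \<in> sets borel \<and> B \<in> sets borel \<and> A \<subseteq> {0..1} \<and> B \<subseteq> {0..1}}.
      \<bar>LINT z:(fst AB \<times> snd AB)|lborel. k1 z - k2 z\<bar>)"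

definition mp_bij :: "(real \<Rightarrow> real) \<Rightarrow> bool" where
  "mp_bij \<sigma> \<longleftrightarrow> bij_betw \<sigma> {0..1} {0..1}
      \<and> \<sigma> \<in> measurable (restrict_space lborel {0..1}) (restrict_space lborel {0..1})
      \<and> distr (restrict_space lborel {0..1}) (restrict_space lborel {0..1}) \<sigma>
           = restrict_space lborel {0..1}"

definition act :: "(real \<Rightarrow> real) \<Rightarrow> (real \<times> real \<Rightarrow> real) \<Rightarrow> (real \<times> real \<Rightarrow> real)" where
  "act \<sigma> k = (\<lambda>(x, y). k (\<sigma> x, \<sigma> y))"

text \<open>The quotient cut distance on orbits, expressed on representatives.\<close>
definition cut_delta :: "(real \<times> real \<Rightarrow> real) \<Rightarrow> (real \<times> real \<Rightarrow> real) \<Rightarrow> real" where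
  "cut_delta k1 k2 = (INF \<sigma> \<in> {\<sigma>. mp_bij \<sigma>}. cut_dist (act \<sigma> k1) k2)"

definition mgf :: "real measure \<Rightarrow> real \<Rightarrow> real" where
  "mgf \<mu> \<theta> = (\<integral>x. exp (\<theta> * x) \<partial>\<mu>)"

definition rate_h :: "real measure \<Rightarrow> real \<Rightarrow> ereal" where
  "rate_h \<mu> x = (SUP \<theta>::real. ereal (\<theta> * x - ln (mgf \<mu> \<theta>)))"

definition rate_I :: "real measure \<Rightarrow> (real \<times> real \<Rightarrow> real) \<Rightarrow> ennreal" where
  "rate_I \<mu> k = (1/2) * (\<integral>\<^sup>+ z \<in> Dsq. e2ennreal (rate_h \<mu> (k z)) \<partial>lborel)"

definition idx :: "nat \<Rightarrow> (nat \<times> nat) set" where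
  "idx n = {(i, j). i \<le> j \<and> j < n}"

definition matrix_law :: "real measure \<Rightarrow> nat \<Rightarrow> (nat \<times> nat \<Rightarrow> real) measure" where
  "matrix_law \<mu> n = PiM (idx n) (\<lambda>_. \<mu>)"

definition sym_entry :: "(nat \<times> nat \<Rightarrow> real) \<Rightarrow> nat \<Rightarrow> nat \<Rightarrow> real" where
  "sym_entry x i j = x (min i j, max i j)"

text \<open>J^n_i = [(i-1)/n, i/n] for i = 1..n, here with 0-based index i: [i/n, (i+1)/n].\<close>
definition Jint :: "nat \<Rightarrow> nat \<Rightarrow> real set" where
  "Jint n i = {real i / real n .. real (Suc i) / real n}"

definition mat_kernel :: "nat \<Rightarrow> (nat \<times> nat \<Rightarrow> real) \<Rightarrow> (real \<times> real \<Rightarrow> real)" where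
  "mat_kernel n x = (\<lambda>(s, t). \<Sum>i<n. \<Sum>j<n.
      sym_entry x i j * indicator (Jint n i) s * indicator (Jint n j) t)"

definition scaled_log :: "nat \<Rightarrow> real \<Rightarrow> ereal" where
  "scaled_log n p = (if p = 0 then -\<infinity> else ereal (ln p / (real n)^2))"

end

(*
  For a test kernel phi put J(phi) = int (phi f - Lambda(phi)) over the unit square, Lambda = log M.
  If phi is a step kernel with classes A_a, then k being within epsilon of f in the quotient cut
  distance (via sigma) forces the quadratic form
  sum_{i,j} sum_{a,b} p_ia p_jb (x_ij phi_ab - Lambda(phi_ab)) to be at least n^2 (J(phi) - O(epsilon)),
  where p_ia is n times the mass of the part of A_a that sigma sends into the i-th interval. Each row
  of p is a probability vector and the off-diagonal part of the form is affine in each row, so p can be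
  rounded to a genuine labelling of the indices. There are only exp(O(n)) labellings, and for each of
  them exponential Chebyshev gives exp(-n^2 J(phi)/2 + O(n)): no regularity lemma or compactness is
  needed. Finally sup J(phi) over step kernels equals the integral of h(f), by density of step
  kernels in L^1 and by maximising theta f - Lambda(theta) pointwise over finitely many rational theta.
*)

theory Submission
  imports Defs
begin

text \<open>A cut ball is a union over all of G, and the weights p coming from the various sigma
  form a continuum, so no union bound applies to them directly. Rounding leaves finitely many
  events, and dividing the logarithm of their number by n^2 removes it in the limit. Affinity in
  each row can fail on the diagonal terms, where row i occurs twice. These n terms are therefore
  split off and bounded by a constant each, which is where boundedness of the entries enters the
  rounding argument. The factor 1/2 in the exponent reflects symmetry: x_ij and x_ji are one random
  variable, so the off-diagonal form is twice a sum of independent terms. The order of choices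
  matters: phi is fixed before epsilon and n, so the number of classes and the size of phi are
  constants in both limits.\<close>

section \<open>Step kernels and their density in L^1 of a finite measure\<close>

definition step_kernel :: "(real \<times> real \<Rightarrow> real) \<Rightarrow> bool" where
  "step_kernel \<phi> \<longleftrightarrow> (\<exists>(\<alpha> :: real \<Rightarrow> nat) \<Theta>. \<alpha> \<in> measurable borel (count_space UNIV) \<and> finite (range \<alpha>)
     \<and> \<phi> = (\<lambda>(s, t). \<Theta> (\<alpha> s) (\<alpha> t)))"

lemma step_kernelI:
  fixes \<alpha> :: "real \<Rightarrow> nat"
  assumes "\<alpha> \<in> measurable borel (count_space UNIV)" "finite (range \<alpha>)"
    and "\<And>s t. \<phi> (s, t) = \<Theta> (\<alpha> s) (\<alpha> t)"
  shows "step_kernel \<phi>"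
  unfolding step_kernel_def using assms
  by (intro exI[of _ \<alpha>] exI[of _ \<Theta>]) auto

lemma step_kernelE:
  assumes "step_kernel \<phi>"
  obtains \<alpha> :: "real \<Rightarrow> nat" and \<Theta> where "\<alpha> \<in> measurable borel (count_space UNIV)" "finite (range \<alpha>)"
    "\<And>s t. \<phi> (s, t) = \<Theta> (\<alpha> s) (\<alpha> t)"
  using assms unfolding step_kernel_def by auto

lemma step_kernel_measurable [measurable_dest]:
  assumes "step_kernel \<phi>"
  shows "\<phi> \<in> borel_measurable borel"
proof -
  obtain \<alpha> :: "real \<Rightarrow> nat" and \<Theta> where a[measurable]: "\<alpha> \<in> measurable borel (count_space UNIV)"
    and p: "\<And>s t. \<phi> (s, t) = \<Theta> (\<alpha> s) (\<alpha> t)"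
    using step_kernelE[OF assms] by metis
  have "\<phi> = (\<lambda>z. (\<lambda>(a, b). \<Theta> a b) (\<alpha> (fst z), \<alpha> (snd z)))"
    using p by (auto simp: fun_eq_iff)
  also have "\<dots> \<in> borel_measurable (borel \<Otimes>\<^sub>M borel)"
    by measurable
  finally show ?thesis by (simp add: borel_prod)
qed

lemma step_kernel_const: "step_kernel (\<lambda>_. c)"
  by (rule step_kernelI[of "\<lambda>_. 0" _ "\<lambda>_ _. c"]) auto

text \<open>The pair of labels, coded as one natural number, labels the common refinement of the two
  partitions, on which both kernels are constant in blocks.\<close>

lemma step_kernel_map2:
  assumes "step_kernel \<phi>" "step_kernel \<psi>"
  shows "step_kernel (\<lambda>z. F (\<phi> z) (\<psi> z))"
proof -
  obtain \<alpha> :: "real \<Rightarrow> nat" and \<Theta> where a[measurable]: "\<alpha> \<in> measurable borel (count_space UNIV)"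
    and fa: "finite (range \<alpha>)" and pa: "\<And>s t. \<phi> (s, t) = \<Theta> (\<alpha> s) (\<alpha> t)"
    using step_kernelE[OF assms(1)] by metis
  obtain \<beta> :: "real \<Rightarrow> nat" and \<Xi> where b[measurable]: "\<beta> \<in> measurable borel (count_space UNIV)"
    and fb: "finite (range \<beta>)" and pb: "\<And>s t. \<psi> (s, t) = \<Xi> (\<beta> s) (\<beta> t)"
    using step_kernelE[OF assms(2)] by metis
  have m: "(\<lambda>s. prod_encode (\<alpha> s, \<beta> s)) \<in> measurable borel (count_space UNIV)"
    by measurable
  have "range (\<lambda>s. prod_encode (\<alpha> s, \<beta> s)) \<subseteq> prod_encode ` (range \<alpha> \<times> range \<beta>)"
    by auto
  then have fin: "finite (range (\<lambda>s. prod_encode (\<alpha> s, \<beta> s)))"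
    using fa fb finite_subset by blast
  show ?thesis
    by (rule step_kernelI[OF m fin, of _ "\<lambda>c d. F (\<Theta> (fst (prod_decode c)) (fst (prod_decode d)))
          (\<Xi> (snd (prod_decode c)) (snd (prod_decode d)))"]) (simp add: pa pb)
qed

text \<open>Both coordinates of a step kernel share one labelling, because later an index must carry
  the same label as a row and as a column. The label therefore stores two bits: it is odd on A and
  at least 2 on B.\<close>

lemma step_kernel_rectangle:
  assumes [measurable]: "A \<in> sets borel" "B \<in> sets borel"
  shows "step_kernel (indicator (A \<times> B))"
proof (rule step_kernelI)
  let ?\<alpha> = "\<lambda>s. (if s \<in> A then 1 else 0) + (if s \<in> B then 2 else 0 :: nat)"
  show "?\<alpha> \<in> measurable borel (count_space UNIV)" by measurable
  have "range ?\<alpha> \<subseteq> {..3}" by auto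
  then show "finite (range ?\<alpha>)" using finite_subset by blast
  show "indicator (A \<times> B) (s, t) =
      (\<lambda>a b. if odd a \<and> b \<ge> 2 then 1 else 0 :: real) (?\<alpha> s) (?\<alpha> t)" for s t
    by (auto simp: indicator_def)
qed

text \<open>Distances in \<open>L\<^sup>1\<close> are taken as nonnegative integrals, so that no integrability has to be
  carried around.\<close>

definition L1_dist :: "'a measure \<Rightarrow> ('a \<Rightarrow> real) \<Rightarrow> ('a \<Rightarrow> real) \<Rightarrow> ennreal" where
  "L1_dist M f g = (\<integral>\<^sup>+z. ennreal \<bar>f z - g z\<bar> \<partial>M)"

lemma L1_dist_triangle:
  assumes [measurable]: "f \<in> borel_measurable M" "g \<in> borel_measurable M" "h \<in> borel_measurable M"
  shows "L1_dist M f h \<le> L1_dist M f g + L1_dist M g h"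
proof -
  have "L1_dist M f h \<le> (\<integral>\<^sup>+z. ennreal \<bar>f z - g z\<bar> + ennreal \<bar>g z - h z\<bar> \<partial>M)"
    unfolding L1_dist_def by (intro nn_integral_mono) (auto simp flip: ennreal_plus)
  also have "\<dots> = L1_dist M f g + L1_dist M g h"
    unfolding L1_dist_def by (intro nn_integral_add) auto
  finally show ?thesis .
qed

lemma L1_dist_add:
  assumes [measurable]: "f \<in> borel_measurable M" "g \<in> borel_measurable M"
    "f' \<in> borel_measurable M" "g' \<in> borel_measurable M"
  shows "L1_dist M (\<lambda>z. f z + g z) (\<lambda>z. f' z + g' z) \<le> L1_dist M f f' + L1_dist M g g'"
proof -
  have "L1_dist M (\<lambda>z. f z + g z) (\<lambda>z. f' z + g' z)
      \<le> (\<integral>\<^sup>+z. ennreal \<bar>f z - f' z\<bar> + ennreal \<bar>g z - g' z\<bar> \<partial>M)"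
    unfolding L1_dist_def by (intro nn_integral_mono) (auto simp flip: ennreal_plus)
  also have "\<dots> = L1_dist M f f' + L1_dist M g g'"
    unfolding L1_dist_def by (intro nn_integral_add) auto
  finally show ?thesis .
qed

text \<open>The measure is left general because the density result is applied to a weight built from
  the absolute value of f, not to Lebesgue measure.\<close>

definition L1_approximable :: "(real \<times> real) measure \<Rightarrow> (real \<times> real \<Rightarrow> real) \<Rightarrow> bool" where
  "L1_approximable M \<psi> \<longleftrightarrow> (\<forall>e>0. \<exists>\<phi>. step_kernel \<phi> \<and> L1_dist M \<psi> \<phi> < ennreal e)"

lemma L1_approximable_step: "step_kernel \<phi> \<Longrightarrow> L1_approximable M \<phi>"
  unfolding L1_approximable_def L1_dist_def by (intro allI impI exI[of _ \<phi>]) auto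

lemma L1_approximable_add:
  assumes "sets M = sets borel" "f \<in> borel_measurable borel" "g \<in> borel_measurable borel"
    and "L1_approximable M f" "L1_approximable M g"
  shows "L1_approximable M (\<lambda>z. f z + g z)"
  unfolding L1_approximable_def
proof (intro allI impI)
  fix e :: real assume e: "e > 0"
  then obtain \<phi> \<psi> where p: "step_kernel \<phi>" "L1_dist M f \<phi> < ennreal (e/2)"
      "step_kernel \<psi>" "L1_dist M g \<psi> < ennreal (e/2)"
    using assms(4,5) unfolding L1_approximable_def by (meson half_gt_zero)
  have meq: "borel_measurable M = (borel_measurable borel :: (real \<times> real \<Rightarrow> real) set)"
    by (rule measurable_cong_sets) (use assms in auto)
  have "L1_dist M (\<lambda>z. f z + g z) (\<lambda>z. \<phi> z + \<psi> z) \<le> L1_dist M f \<phi> + L1_dist M g \<psi>"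
    by (rule L1_dist_add) (use assms p step_kernel_measurable in \<open>auto simp: meq\<close>)
  also have "\<dots> < ennreal (e/2) + ennreal (e/2)" using p by (intro add_strict_mono) auto
  also have "\<dots> = ennreal e" using e by (simp flip: ennreal_plus)
  finally have "L1_dist M (\<lambda>z. f z + g z) (\<lambda>z. \<phi> z + \<psi> z) < ennreal e" .
  then show "\<exists>\<phi>. step_kernel \<phi> \<and> L1_dist M (\<lambda>z. f z + g z) \<phi> < ennreal e"
    using step_kernel_map2[OF p(1,3), of "(+)"] by blast
qed

lemma L1_approximable_scale:
  assumes "sets M = sets borel" "f \<in> borel_measurable borel" "L1_approximable M f"
  shows "L1_approximable M (\<lambda>z. c * f z)"
  unfolding L1_approximable_def
proof (intro allI impI)
  fix e :: real assume e: "e > 0"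
  \<comment> \<open>Adding 1 covers c = 0 and makes the final inequality strict.\<close>
  have "e / (\<bar>c\<bar> + 1) > 0" using e by auto
  then obtain \<phi> where p: "step_kernel \<phi>" "L1_dist M f \<phi> < ennreal (e / (\<bar>c\<bar> + 1))"
    using assms(3) unfolding L1_approximable_def by meson
  have [measurable_cong]: "sets M = sets borel" by fact
  have [measurable]: "f \<in> borel_measurable borel" "\<phi> \<in> borel_measurable borel"
    using assms p step_kernel_measurable by auto
  have "L1_dist M (\<lambda>z. c * f z) (\<lambda>z. c * \<phi> z) = ennreal \<bar>c\<bar> * L1_dist M f \<phi>"
    unfolding L1_dist_def
    by (subst nn_integral_cmult[symmetric])
       (auto simp: abs_mult ennreal_mult' right_diff_distrib[symmetric])
  also have "\<dots> \<le> ennreal \<bar>c\<bar> * ennreal (e / (\<bar>c\<bar> + 1))"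
    using p by (intro mult_left_mono) auto
  also have "\<dots> = ennreal (\<bar>c\<bar> * (e / (\<bar>c\<bar> + 1)))"
    using e by (simp flip: ennreal_mult')
  also have "\<dots> < ennreal e"
    using e by (intro ennreal_lessI) (auto simp: field_simps)
  finally have "L1_dist M (\<lambda>z. c * f z) (\<lambda>z. c * \<phi> z) < ennreal e" .
  then show "\<exists>\<phi>. step_kernel \<phi> \<and> L1_dist M (\<lambda>z. c * f z) \<phi> < ennreal e"
    using step_kernel_map2[OF p(1) p(1), of "\<lambda>a _. c * a"] by blast
qed

lemma L1_approximable_sum:
  assumes "sets M = sets borel" "finite I"
    and "\<And>i. i \<in> I \<Longrightarrow> f i \<in> borel_measurable borel"
    and "\<And>i. i \<in> I \<Longrightarrow> L1_approximable M (f i)"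
  shows "L1_approximable M (\<lambda>z. \<Sum>i\<in>I. f i z)"
  using assms(2-4)
proof (induction I rule: finite_induct)
  case empty
  then show ?case by (simp add: L1_approximable_step step_kernel_const)
next
  case (insert x F)
  then show ?case using L1_approximable_add[OF assms(1), of "f x" "\<lambda>z. \<Sum>i\<in>F. f i z"]
    by (auto intro!: borel_measurable_sum)
qed

text \<open>A Dynkin argument: rectangles form an intersection-stable generator of the Borel sets of
  the plane. Complements are affine images of indicators. A countable disjoint union is truncated to
  finitely many sets, and finiteness of M makes the remaining mass small.\<close>

lemma L1_approximable_indicator:
  assumes "finite_measure M" "sets M = sets borel" "S \<in> sets borel"
  shows "L1_approximable M (indicator S)"
proof -
  interpret finite_measure M by fact
  have [measurable_cong]: "sets M = sets borel" by fact
  have sp: "space M = UNIV" using sets_eq_imp_space_eq[OF assms(2)] by simp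
  let ?R = "{A \<times> B | A B. A \<in> sets (borel :: real measure) \<and> B \<in> sets (borel :: real measure)}"
  have gen: "sets (borel :: (real \<times> real) measure) = sigma_sets UNIV ?R"
    by (subst borel_prod[symmetric]) (simp add: sets_pair_measure)
  have ist: "Int_stable ?R" using Int_stable_pair_measure_generator[of borel borel] by simp
  have subset_Pow: "?R \<subseteq> Pow UNIV" by simp
  from assms(3) have "S \<in> sigma_sets UNIV ?R" using gen by simp
  then show ?thesis
  proof (induction rule: sigma_sets_induct_disjoint[OF ist subset_Pow, consumes 1, case_names basic empty compl union])
    case (basic A)
    then show ?case using step_kernel_rectangle L1_approximable_step by auto
  next
    case empty
    show ?case using step_kernel_const[of 0] by (simp add: L1_approximable_step)
  next
    case (compl A)
    then have [measurable]: "A \<in> sets borel" using gen by simp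
    have "indicator (UNIV - A) = (\<lambda>z. 1 + (-1) * (indicator A z :: real))"
      by (auto simp: indicator_def fun_eq_iff)
    then show ?case
      using L1_approximable_add[OF assms(2) _ _ L1_approximable_step[OF step_kernel_const]
          L1_approximable_scale[OF assms(2) _ compl(2), of "-1"], of 1] by simp
  next
    case (union A)
    have A[measurable]: "A i \<in> sets borel" for i
      unfolding gen by (rule subsetD[OF union(2)]) (rule rangeI)
    show ?case
      unfolding L1_approximable_def
    proof (intro allI impI)
      fix e :: real assume e: "e > 0"
      define P where "P n = (\<Union>i<n. A i)" for n
      have [measurable]: "P n \<in> sets borel" for n unfolding P_def by auto
      have "(\<lambda>n. measure M (P n)) \<longlonglongrightarrow> measure M (\<Union>n. P n)"
      proof (rule finite_Lim_measure_incseq)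
        show "range P \<subseteq> sets M" by (auto simp: assms(2))
        show "incseq P" unfolding P_def by (intro monoI UN_mono) auto
      qed
      moreover have "(\<Union>n. P n) = (\<Union>n. A n)" unfolding P_def by auto
      ultimately have "(\<lambda>n. measure M (P n)) \<longlonglongrightarrow> measure M (\<Union>n. A n)" by simp
      then obtain n where n: "\<bar>measure M (P n) - measure M (\<Union>n. A n)\<bar> < e/2"
        using e unfolding LIMSEQ_def dist_real_def by (meson half_gt_zero order_refl)
      have d: "L1_dist M (indicator (\<Union>n. A n)) (indicator (P n)) < ennreal (e/2)"
      proof -
        have "L1_dist M (indicator (\<Union>n. A n)) (indicator (P n))
            = (\<integral>\<^sup>+z. indicator ((\<Union>n. A n) - P n) z \<partial>M)"
          unfolding L1_dist_def P_def by (intro nn_integral_cong) (auto simp: indicator_def)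
        also have "\<dots> = ennreal (measure M ((\<Union>n. A n) - P n))"
          by (subst nn_integral_indicator) (auto simp: assms(2) emeasure_eq_measure)
        also have "measure M ((\<Union>n. A n) - P n) = measure M (\<Union>n. A n) - measure M (P n)"
          by (rule finite_measure_Diff) (auto simp: assms(2) P_def)
        also have "ennreal \<dots> < ennreal (e/2)"
          using n e by (intro ennreal_lessI) linarith+
        finally show ?thesis .
      qed
      have "indicator (P n) = (\<lambda>z. \<Sum>i<n. indicator (A i) z :: real)"
        unfolding P_def using union(1) by (intro ext indicator_UN_disjoint) (auto simp: disjoint_family_on_def)
      moreover have "L1_approximable M (\<lambda>z. \<Sum>i<n. indicator (A i) z :: real)"
        by (rule L1_approximable_sum[OF assms(2)]) (use union(3) in auto)
      ultimately obtain \<phi> where p: "step_kernel \<phi>" "L1_dist M (indicator (P n)) \<phi> < ennreal (e/2)"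
        unfolding L1_approximable_def using e by (metis half_gt_zero)
      have [measurable]: "\<phi> \<in> borel_measurable borel" using p step_kernel_measurable by auto
      have "L1_dist M (indicator (\<Union>n. A n)) \<phi>
          \<le> L1_dist M (indicator (\<Union>n. A n)) (indicator (P n)) + L1_dist M (indicator (P n)) \<phi>"
        by (rule L1_dist_triangle) auto
      also have "\<dots> < ennreal (e/2) + ennreal (e/2)"
        using p d by (intro add_strict_mono) auto
      also have "\<dots> = ennreal e" using e by (simp flip: ennreal_plus)
      finally show "\<exists>\<phi>. step_kernel \<phi> \<and> L1_dist M (indicator (\<Union>n. A n)) \<phi> < ennreal e"
        using p by blast
    qed
  qed
qed

lemma L1_approximable_finite_range:
  assumes "finite_measure M" "sets M = sets borel"
    and [measurable]: "\<psi> \<in> borel_measurable borel" and "finite (range \<psi>)"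
  shows "L1_approximable M \<psi>"
proof -
  have eq: "\<psi> = (\<lambda>z. \<Sum>q\<in>range \<psi>. q * indicator (\<psi> -` {q}) z)"
    using assms(4) by (auto simp: fun_eq_iff indicator_def if_distrib sum.delta' cong: if_cong)
  have v: "\<psi> -` {q} \<in> sets borel" for q
    using measurable_sets[OF assms(3), of "{q}"] by simp
  have "L1_approximable M (\<lambda>z. \<Sum>q\<in>range \<psi>. q * indicator (\<psi> -` {q}) z)"
    by (intro L1_approximable_sum assms L1_approximable_scale L1_approximable_indicator)
       (auto simp: v intro!: borel_measurable_times borel_measurable_indicator)
  then show ?thesis using eq by simp
qed

section \<open>Rounding fractional labels\<close>

text \<open>If the labels of the indices are drawn independently with laws \<open>p i\<close>, the
  left side is the expectation of the right side, since only pairs of distinct indices occur; some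
  outcome reaches the mean. The proof fixes the labels one at a time, replacing a row by a point
  mass without lowering the form.\<close>

lemma exists_labelling_ge_average:
  fixes w :: "nat \<Rightarrow> nat \<Rightarrow> 'a \<Rightarrow> 'a \<Rightarrow> real" and p :: "nat \<Rightarrow> 'a \<Rightarrow> real"
  assumes R: "finite R" and p0: "\<And>i a. i < n \<Longrightarrow> a \<in> R \<Longrightarrow> 0 \<le> p i a"
    and p1: "\<And>i. i < n \<Longrightarrow> (\<Sum>a\<in>R. p i a) = 1"
  shows "\<exists>\<alpha> \<in> {..<n} \<rightarrow>\<^sub>E R.
    (\<Sum>i<n. \<Sum>j\<in>{..<n}-{i}. \<Sum>a\<in>R. \<Sum>b\<in>R. p i a * p j b * w i j a b)
      \<le> (\<Sum>i<n. \<Sum>j\<in>{..<n}-{i}. w i j (\<alpha> i) (\<alpha> j))"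
proof -
  define G where "G q i j = (\<Sum>a\<in>R. \<Sum>b\<in>R. q i a * q j b * w i j a b)"
    for q :: "nat \<Rightarrow> 'a \<Rightarrow> real" and i j
  define F where "F q = (\<Sum>i<n. \<Sum>j\<in>{..<n}-{i}. G q i j)" for q
  define \<delta> where "\<delta> c a = (if a = c then 1 else 0 :: real)" for c a :: 'a
  \<comment> \<open>For distinct i and j, row k enters \<open>G\<close> at most once. If it enters,
    \<open>G\<close> is linear in it; if not, \<open>G\<close> is constant in it and the identity
    only uses the row sum 1.\<close>
  have affine: "G q i j = (\<Sum>c\<in>R. q k c * G (q(k := \<delta> c)) i j)"
    if q1: "(\<Sum>a\<in>R. q k a) = 1" and ij: "i \<noteq> j" for q i j k
  proof -
    have col: "(\<Sum>a\<in>R. \<delta> c a * g a) = g c" if "c \<in> R" for c and g :: "'a \<Rightarrow> real"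
      using R that by (simp add: \<delta>_def if_distrib[of "\<lambda>x. x * _"] sum.delta cong: if_cong)
    consider "i = k" | "j = k" "i \<noteq> k" | "i \<noteq> k" "j \<noteq> k" by auto
    then show ?thesis
    proof cases
      case 1
      have "G (q(k := \<delta> c)) i j = (\<Sum>b\<in>R. q j b * w i j c b)" if "c \<in> R" for c
      proof -
        have "G (q(k := \<delta> c)) i j = (\<Sum>a\<in>R. \<delta> c a * (\<Sum>b\<in>R. q j b * w i j a b))"
          using 1 ij by (simp add: G_def sum_distrib_left mult.assoc)
        then show ?thesis using col[OF that] by simp
      qed
      then show ?thesis
        using 1 by (simp add: G_def sum_distrib_left mult.assoc)
    next
      case 2
      have "G (q(k := \<delta> c)) i j = (\<Sum>a\<in>R. q i a * w i j a c)" if "c \<in> R" for c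
      proof -
        have "G (q(k := \<delta> c)) i j = (\<Sum>a\<in>R. \<Sum>b\<in>R. \<delta> c b * (q i a * w i j a b))"
          using 2 by (simp add: G_def mult_ac)
        then show ?thesis using col[OF that] by simp
      qed
      then have "(\<Sum>c\<in>R. q k c * G (q(k := \<delta> c)) i j)
          = (\<Sum>c\<in>R. \<Sum>a\<in>R. q i a * q j c * w i j a c)"
        using 2 by (simp add: sum_distrib_left mult_ac)
      also have "\<dots> = G q i j" unfolding G_def by (rule sum.swap)
      finally show ?thesis ..
    next
      case 3
      then have "G (q(k := \<delta> c)) i j = G q i j" for c by (simp add: G_def)
      then show ?thesis using q1 by (simp add: sum_distrib_right[symmetric])
    qed
  qed
  have step: "\<exists>c\<in>R. F q \<le> F (q(k := \<delta> c))"
    if q1: "(\<Sum>a\<in>R. q k a) = 1" and q0: "\<And>a. a \<in> R \<Longrightarrow> 0 \<le> q k a" for q k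
  proof (rule ccontr)
    assume "\<not> ?thesis"
    then have lt: "F (q(k := \<delta> c)) < F q" if "c \<in> R" for c using that by force
    have "F q = (\<Sum>i<n. \<Sum>j\<in>{..<n}-{i}. \<Sum>c\<in>R. q k c * G (q(k := \<delta> c)) i j)"
      unfolding F_def by (intro sum.cong refl affine q1) auto
    also have "\<dots> = (\<Sum>i<n. \<Sum>c\<in>R. \<Sum>j\<in>{..<n}-{i}. q k c * G (q(k := \<delta> c)) i j)"
      by (intro sum.cong refl sum.swap)
    also have "\<dots> = (\<Sum>c\<in>R. \<Sum>i<n. \<Sum>j\<in>{..<n}-{i}. q k c * G (q(k := \<delta> c)) i j)"
      by (rule sum.swap)
    also have "\<dots> = (\<Sum>c\<in>R. q k c * F (q(k := \<delta> c)))"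
      by (simp add: F_def sum_distrib_left)
    finally have eq: "F q = (\<Sum>c\<in>R. q k c * F (q(k := \<delta> c)))" .
    \<comment> \<open>One label of positive weight, which exists because the weights sum to 1, makes
      the comparison of averages strict.\<close>
    obtain c0 where c0: "c0 \<in> R" "0 < q k c0"
      using q1 q0 by (metis less_eq_real_def sum.neutral zero_neq_one)
    have "(\<Sum>c\<in>R. q k c * F (q(k := \<delta> c))) < (\<Sum>c\<in>R. q k c * F q)"
    proof (rule sum_strict_mono_ex1)
      show "\<forall>c\<in>R. q k c * F (q(k := \<delta> c)) \<le> q k c * F q"
      proof
        fix c assume "c \<in> R"
        with lt[of c] q0[of c] show "q k c * F (q(k := \<delta> c)) \<le> q k c * F q"
          by (intro mult_left_mono) simp_all
      qed
      show "\<exists>c\<in>R. q k c * F (q(k := \<delta> c)) < q k c * F q"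
        using mult_strict_left_mono[OF lt[OF c0(1)] c0(2)] c0(1) by (rule bexI)
    qed (rule R)
    also have "\<dots> = (\<Sum>c\<in>R. q k c) * F q" by (rule sum_distrib_right[symmetric])
    also have "\<dots> = F q" using q1 by simp
    finally show False using eq by simp
  qed
  \<comment> \<open>Invariant of the rounding: the first m rows are already point masses, while row
    m is still the original probability vector, as \<open>step\<close> requires.\<close>
  have ind: "\<exists>\<alpha>. (\<forall>i<m. \<alpha> i \<in> R) \<and> F p \<le> F (\<lambda>i. if i < m then \<delta> (\<alpha> i) else p i)" if "m \<le> n" for m
    using that
  proof (induction m)
    case 0
    then show ?case by simp
  next
    case (Suc m)
    then obtain \<alpha> where a: "\<forall>i<m. \<alpha> i \<in> R" "F p \<le> F (\<lambda>i. if i < m then \<delta> (\<alpha> i) else p i)" by auto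
    let ?q = "\<lambda>i. if i < m then \<delta> (\<alpha> i) else p i"
    obtain c where c: "c \<in> R" "F ?q \<le> F (?q(m := \<delta> c))"
      using step[of ?q m] p0 p1 Suc.prems by auto
    have "?q(m := \<delta> c) = (\<lambda>i. if i < Suc m then \<delta> ((\<alpha>(m := c)) i) else p i)"
      by (auto simp: fun_eq_iff less_Suc_eq)
    then show ?case using a c by (intro exI[of _ "\<alpha>(m := c)"]) (auto simp: less_Suc_eq)
  qed
  obtain \<alpha> where a: "\<forall>i<n. \<alpha> i \<in> R" "F p \<le> F (\<lambda>i. if i < n then \<delta> (\<alpha> i) else p i)"
    using ind[of n] by auto
  have "G (\<lambda>i. if i < n then \<delta> (\<alpha> i) else p i) i j = w i j (\<alpha> i) (\<alpha> j)" if "i < n" "j < n" for i j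
  proof -
    have "(\<Sum>b\<in>R. \<delta> (\<alpha> i) a * \<delta> (\<alpha> j) b * w i j a b) = (if a = \<alpha> i then w i j a (\<alpha> j) else 0)" for a
      using that a(1) R by (simp add: \<delta>_def if_distrib[of "\<lambda>x. x * _"] sum.delta cong: if_cong)
    then have "G (\<lambda>i. if i < n then \<delta> (\<alpha> i) else p i) i j
        = (\<Sum>a\<in>R. if a = \<alpha> i then w i j a (\<alpha> j) else 0)"
      using that by (simp add: G_def)
    then show ?thesis using that a(1) R by (simp add: sum.delta)
  qed
  then have Feq: "F (\<lambda>i. if i < n then \<delta> (\<alpha> i) else p i) = (\<Sum>i<n. \<Sum>j\<in>{..<n}-{i}. w i j (\<alpha> i) (\<alpha> j))"
    unfolding F_def by (intro sum.cong refl) auto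
  show ?thesis
  \<comment> \<open>Restriction makes the labelling extensional, so that it lies in a finite set of
    \<open>card R ^ n\<close> functions, the number that the later union bound counts.\<close>
  proof (rule bexI[of _ "restrict \<alpha> {..<n}"])
    show "restrict \<alpha> {..<n} \<in> {..<n} \<rightarrow>\<^sub>E R" using a(1) by auto
    have "(\<Sum>i<n. \<Sum>j\<in>{..<n}-{i}. w i j (restrict \<alpha> {..<n} i) (restrict \<alpha> {..<n} j))
        = (\<Sum>i<n. \<Sum>j\<in>{..<n}-{i}. w i j (\<alpha> i) (\<alpha> j))"
      by (intro sum.cong refl) auto
    then show "(\<Sum>i<n. \<Sum>j\<in>{..<n}-{i}. \<Sum>a\<in>R. \<Sum>b\<in>R. p i a * p j b * w i j a b)
        \<le> (\<Sum>i<n. \<Sum>j\<in>{..<n}-{i}. w i j (restrict \<alpha> {..<n} i) (restrict \<alpha> {..<n} j))"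
      using a(2) Feq unfolding F_def G_def by linarith
  qed
qed

section \<open>Exponential Chebyshev bound and the log moment generating function\<close>

text \<open>Markov's inequality for the exponential of the sum: by independence its expectation is a
  product of factors at most 1. The normalising terms \<open>cgf\<close> are meant to be part of
  \<open>h\<close>, which is why the bound carries no moment generating function.\<close>

lemma (in prob_space) chernoff_PiM:
  assumes I: "finite I" and [measurable]: "\<And>i. i \<in> I \<Longrightarrow> h i \<in> borel_measurable M"
    and int: "\<And>i. i \<in> I \<Longrightarrow> integrable M (\<lambda>x. exp (h i x))"
    and le1: "\<And>i. i \<in> I \<Longrightarrow> (\<integral>x. exp (h i x) \<partial>M) \<le> 1"
  shows "measure (PiM I (\<lambda>_. M)) {x \<in> space (PiM I (\<lambda>_. M)). t \<le> (\<Sum>i\<in>I. h i (x i))} \<le> exp (- t)"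
proof -
  interpret P: product_prob_space "\<lambda>_. M" I by unfold_locales
  let ?P = "PiM I (\<lambda>_. M)"
  have expeq: "exp (\<Sum>i\<in>I. h i (x i)) = (\<Prod>i\<in>I. exp (h i (x i)))" for x
    by (rule exp_sum[OF I])
  have i1: "integrable ?P (\<lambda>x. exp (\<Sum>i\<in>I. h i (x i)))"
    unfolding expeq by (rule P.product_integrable_prod[OF I int])
  have i2: "(\<integral>x. exp (\<Sum>i\<in>I. h i (x i)) \<partial>?P) \<le> 1"
    unfolding expeq using le1
    by (subst P.product_integral_prod[OF I int]) (auto intro!: prod_le_1)
  have "{x \<in> space ?P. t \<le> (\<Sum>i\<in>I. h i (x i))} = {x \<in> space ?P. exp t \<le> exp (\<Sum>i\<in>I. h i (x i))}"
    by simp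
  also have "measure ?P \<dots> \<le> (\<integral>x. exp (\<Sum>i\<in>I. h i (x i)) \<partial>?P) / exp t"
    by (rule integral_Markov_inequality_measure[OF i1, of "space ?P" for A, simplified]) auto
  also have "\<dots> \<le> 1 / exp t" using i2 by (intro divide_right_mono) auto
  finally show ?thesis by (simp add: exp_minus field_simps)
qed

locale bounded_law = prob_space \<mu> for \<mu> :: "real measure" +
  fixes l :: real
  assumes sets_law [measurable_cong]: "sets \<mu> = sets borel"
    and AE_bounded: "AE x in \<mu>. \<bar>x\<bar> \<le> l"
begin

definition cgf :: "real \<Rightarrow> real" where
  "cgf \<theta> = ln (mgf \<mu> \<theta>)"

lemma l_nonneg: "0 \<le> l"
proof -
  have "AE x in \<mu>. 0 \<le> l" using AE_bounded by eventually_elim auto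
  then show ?thesis by simp
qed

lemma integrable_exp: "integrable \<mu> (\<lambda>x. exp (\<theta> * x))"
proof (rule integrable_const_bound)
  show "AE x in \<mu>. norm (exp (\<theta> * x)) \<le> exp (\<bar>\<theta>\<bar> * l)"
    using AE_bounded
  proof eventually_elim
    case (elim x)
    have "\<theta> * x \<le> \<bar>\<theta>\<bar> * \<bar>x\<bar>" by (metis abs_ge_self abs_mult)
    also have "\<dots> \<le> \<bar>\<theta>\<bar> * l" using elim by (intro mult_left_mono) auto
    finally show ?case by simp
  qed
  show "(\<lambda>x. exp (\<theta> * x)) \<in> borel_measurable \<mu>" by measurable
qed

text \<open>Since \<bar>x\<bar> \<le> l almost surely, moving the parameter changes the exponent by
  at most l times the displacement. This one comparison gives both positivity of \<open>mgf\<close>,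
  by comparing with the parameter 0, and the Lipschitz bound for \<open>cgf\<close>.\<close>

lemma mgf_le: "mgf \<mu> \<theta> \<le> exp (l * \<bar>\<theta> - \<theta>'\<bar>) * mgf \<mu> \<theta>'"
proof -
  have "mgf \<mu> \<theta> \<le> (\<integral>x. exp (l * \<bar>\<theta> - \<theta>'\<bar>) * exp (\<theta>' * x) \<partial>\<mu>)"
    unfolding mgf_def
  proof (rule integral_mono_AE)
    show "AE x in \<mu>. exp (\<theta> * x) \<le> exp (l * \<bar>\<theta> - \<theta>'\<bar>) * exp (\<theta>' * x)"
      using AE_bounded
    proof eventually_elim
      case (elim x)
      have "(\<theta> - \<theta>') * x \<le> \<bar>\<theta> - \<theta>'\<bar> * \<bar>x\<bar>" by (metis abs_ge_self abs_mult)
      also have "\<dots> \<le> \<bar>\<theta> - \<theta>'\<bar> * l" using elim by (intro mult_left_mono) auto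
      finally show ?case by (simp add: exp_add[symmetric] algebra_simps)
    qed
    show "integrable \<mu> (\<lambda>x. exp (\<theta> * x))" by (rule integrable_exp)
    show "integrable \<mu> (\<lambda>x. exp (l * \<bar>\<theta> - \<theta>'\<bar>) * exp (\<theta>' * x))"
      by (intro integrable_mult_right integrable_exp)
  qed
  then show ?thesis by (simp add: mgf_def)
qed

lemma mgf_0: "mgf \<mu> 0 = 1"
  by (simp add: mgf_def prob_space)

lemma mgf_pos: "0 < mgf \<mu> \<theta>"
proof -
  have "1 \<le> exp (l * \<bar>\<theta>\<bar>) * mgf \<mu> \<theta>" using mgf_le[of 0 \<theta>] by (simp add: mgf_0)
  then show ?thesis by (metis exp_gt_zero less_le_trans zero_less_mult_pos zero_less_one)
qed

lemma cgf_0: "cgf 0 = 0"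
  by (simp add: cgf_def mgf_0)

lemma cgf_lipschitz: "\<bar>cgf \<theta> - cgf \<theta>'\<bar> \<le> l * \<bar>\<theta> - \<theta>'\<bar>"
proof -
  have "cgf \<theta> \<le> l * \<bar>\<theta> - \<theta>'\<bar> + cgf \<theta>'" for \<theta> \<theta>'
  proof -
    have "cgf \<theta> \<le> ln (exp (l * \<bar>\<theta> - \<theta>'\<bar>) * mgf \<mu> \<theta>')"
      unfolding cgf_def by (rule ln_mono) (use mgf_pos mgf_le in auto)
    then show ?thesis using mgf_pos[of \<theta>'] by (simp add: ln_mult cgf_def)
  qed
  from this[of \<theta> \<theta>'] this[of \<theta>' \<theta>] show ?thesis by (simp add: abs_minus_commute abs_le_iff)
qed

lemma cgf_measurable [measurable]: "cgf \<in> borel_measurable borel"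
proof -
  have "continuous_on UNIV cgf"
  proof (rule lipschitz_on_continuous_on)
    show "l-lipschitz_on UNIV cgf"
      using cgf_lipschitz l_nonneg by (intro lipschitz_onI) (auto simp: dist_real_def)
  qed
  then show ?thesis by (rule borel_measurable_continuous_onI)
qed

lemma exp_tilt:
  shows integrable_exp_tilt: "integrable \<mu> (\<lambda>x. exp (\<theta> * x - cgf \<theta>))"
    and integral_exp_tilt: "(\<integral>x. exp (\<theta> * x - cgf \<theta>) \<partial>\<mu>) = 1"
proof -
  have eq: "exp (\<theta> * x - cgf \<theta>) = exp (\<theta> * x) / mgf \<mu> \<theta>" for x
    using mgf_pos by (simp add: exp_diff cgf_def)
  show "integrable \<mu> (\<lambda>x. exp (\<theta> * x - cgf \<theta>))"
    unfolding eq using integrable_exp by (intro integrable_divide)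
  show "(\<integral>x. exp (\<theta> * x - cgf \<theta>) \<partial>\<mu>) = 1"
    unfolding eq using mgf_pos[of \<theta>] by (simp add: mgf_def)
qed

text \<open>Averaging two tilts costs nothing, by convexity of the exponential. This makes it unnecessary
  to symmetrise test kernels.\<close>

lemma exp_mean_tilt:
  fixes \<theta> \<theta>' :: real
  defines "g \<equiv> (\<lambda>x. ((\<theta> * x - cgf \<theta>) + (\<theta>' * x - cgf \<theta>')) / 2)"
  shows integrable_exp_mean_tilt: "integrable \<mu> (\<lambda>x. exp (g x))"
    and integral_exp_mean_tilt: "(\<integral>x. exp (g x) \<partial>\<mu>) \<le> 1"
proof -
  have conv: "exp (g x) \<le> (exp (\<theta> * x - cgf \<theta>) + exp (\<theta>' * x - cgf \<theta>')) / 2" for x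
  proof -
    have "0 \<le> (exp ((\<theta> * x - cgf \<theta>) / 2) - exp ((\<theta>' * x - cgf \<theta>') / 2))\<^sup>2" by simp
    also have "\<dots> = exp (\<theta> * x - cgf \<theta>) + exp (\<theta>' * x - cgf \<theta>') - 2 * exp (g x)"
      by (simp add: g_def power2_eq_square algebra_simps flip: exp_add) (simp add: field_simps)
    finally show ?thesis by simp
  qed
  have i: "integrable \<mu> (\<lambda>x. (exp (\<theta> * x - cgf \<theta>) + exp (\<theta>' * x - cgf \<theta>')) / 2)"
    by (intro integrable_divide Bochner_Integration.integrable_add integrable_exp_tilt)
  show ig: "integrable \<mu> (\<lambda>x. exp (g x))"
  proof (rule Bochner_Integration.integrable_bound[OF i])
    show "(\<lambda>x. exp (g x)) \<in> borel_measurable \<mu>" unfolding g_def by measurable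
    show "AE x in \<mu>. norm (exp (g x)) \<le> norm ((exp (\<theta> * x - cgf \<theta>) + exp (\<theta>' * x - cgf \<theta>')) / 2)"
      using conv by (intro AE_I2) (auto intro: order_trans)
  qed
  have "(\<integral>x. exp (g x) \<partial>\<mu>) \<le> (\<integral>x. (exp (\<theta> * x - cgf \<theta>) + exp (\<theta>' * x - cgf \<theta>')) / 2 \<partial>\<mu>)"
    by (intro integral_mono ig i conv)
  also have "\<dots> = 1"
    using integrable_exp_tilt integral_exp_tilt by simp
  finally show "(\<integral>x. exp (g x) \<partial>\<mu>) \<le> 1" .
qed

end

section \<open>Cut distance and cell masses pulled back by a measure-preserving bijection\<close>

lemma Dsq_sets [measurable]: "Dsq \<in> sets borel"
  unfolding Dsq_def by (auto intro: borel_closed closed_Times)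

lemma emeasure_Dsq_finite: "emeasure lborel Dsq < \<infinity>"
proof -
  have "Dsq = cbox (0, 0) (1, 1 :: real)" unfolding Dsq_def by (auto simp: cbox_Pair_eq)
  then show ?thesis using emeasure_lborel_cbox_finite by metis
qed

text \<open>L^2 lies in L^1 on a set of finite measure, through \<bar>u\<bar> \<le> 1 + u^2.\<close>

lemma kernel_space_set_integrable:
  assumes "f \<in> kernel_space"
  shows "set_integrable lborel Dsq f"
proof -
  have m: "set_borel_measurable lborel Dsq f" and sq: "set_integrable lborel Dsq (\<lambda>z. (f z)\<^sup>2)"
    using assms unfolding kernel_space_def by auto
  have "set_integrable lborel Dsq (\<lambda>z. 1 + (f z)\<^sup>2)"
    using emeasure_Dsq_finite sq by (intro set_integral_add) (auto simp: set_integrable_def)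
  then show ?thesis
    unfolding set_integrable_def
  proof (rule Bochner_Integration.integrable_bound)
    show "(\<lambda>z. indicator Dsq z *\<^sub>R f z) \<in> borel_measurable lborel"
      using m unfolding set_borel_measurable_def .
    have "\<bar>u\<bar> \<le> 1 + u\<^sup>2" for u :: real
      using zero_le_power2[of "\<bar>u\<bar> - 1"] zero_le_power2[of u]
      unfolding power2_diff power2_abs power_one by linarith
    then show "AE z in lborel. norm (indicator Dsq z *\<^sub>R f z) \<le> norm (indicator Dsq z *\<^sub>R (1 + (f z)\<^sup>2))"
      by (intro AE_I2) (auto simp: indicator_def)
  qed
qed

text \<open>A supremum of reals dominates the members of the family only once the family is known to
  be bounded above; here the L^1 norm on the square is a bound, whence the integrability
  assumption.\<close>

lemma rectangle_integral_le_cut_dist: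
  assumes "set_integrable lborel Dsq (\<lambda>z. k z - k' z)"
    and "A \<in> sets borel" "B \<in> sets borel" "A \<subseteq> {0..1}" "B \<subseteq> {0..1}"
  shows "\<bar>LINT z:A \<times> B|lborel. k z - k' z\<bar> \<le> cut_dist k k'"
  unfolding cut_dist_def
proof (rule cSUP_upper2[where x = "(A, B)"])
  let ?I = "{(A, B). A \<in> sets borel \<and> B \<in> sets borel \<and> A \<subseteq> {0..1::real} \<and> B \<subseteq> {0..1::real}}"
  show "bdd_above ((\<lambda>AB. \<bar>LINT z:fst AB \<times> snd AB|lborel. k z - k' z\<bar>) ` ?I)"
  proof (rule bdd_aboveI2)
    fix AB assume "AB \<in> ?I"
    then obtain A B where AB: "AB = (A, B)" "A \<in> sets borel" "B \<in> sets borel" "A \<times> B \<subseteq> Dsq"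
      unfolding Dsq_def by auto
    then have mAB: "A \<times> B \<in> sets (lborel :: (real \<times> real) measure)"
      by (auto simp: borel_prod[symmetric])
    have i: "set_integrable lborel (A \<times> B) (\<lambda>z. k z - k' z)"
      by (rule set_integrable_subset[OF assms(1) mAB AB(4)])
    have "\<bar>LINT z:A \<times> B|lborel. k z - k' z\<bar> \<le> (LINT z:A \<times> B|lborel. \<bar>k z - k' z\<bar>)"
      using set_integral_norm_bound[OF i] by simp
    also have "\<dots> \<le> (LINT z:Dsq|lborel. \<bar>k z - k' z\<bar>)"
      unfolding set_lebesgue_integral_def using AB(4)
      by (intro integral_mono)
         (use set_integrable_abs[OF i] set_integrable_abs[OF assms(1)] in
           \<open>auto simp: set_integrable_def indicator_def\<close>)
    finally show "\<bar>LINT z:fst AB \<times> snd AB|lborel. k z - k' z\<bar> \<le> (LINT z:Dsq|lborel. \<bar>k z - k' z\<bar>)"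
      using AB by simp
  qed
qed (use assms in auto)

lemma Jint_subset: "n > 0 \<Longrightarrow> i < n \<Longrightarrow> Jint n i \<subseteq> {0..1}"
  unfolding Jint_def by (auto simp: field_simps intro: order_trans)

lemma Jint_cover: "n > 0 \<Longrightarrow> u \<in> {0..1} \<Longrightarrow> \<exists>i<n. u \<in> Jint n i"
proof (cases "u = 1")
  case True
  assume "n > 0"
  \<comment> \<open>The floor formula of the other case would give the index n at u = 1.\<close>
  then show ?thesis using True by (intro exI[of _ "n - 1"]) (auto simp: Jint_def field_simps)
next
  case False
  assume n: "n > 0" and u: "u \<in> {0..1}"
  let ?i = "nat \<lfloor>real n * u\<rfloor>"
  have "0 \<le> real n * u" "real n * u < real n" using n u False by auto
  then have "?i < n" "real ?i \<le> real n * u" "real n * u \<le> real (Suc ?i)" by linarith+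
  then show ?thesis using n by (intro exI[of _ ?i]) (auto simp: Jint_def field_simps)
qed

lemma subset_unit_fmeasurable:
  assumes "A \<in> sets borel" "A \<subseteq> {0..1::real}"
  shows "A \<in> fmeasurable lborel"
  by (rule fmeasurableI2[of "{0..1}"]) (use assms in \<open>auto simp: fmeasurable_def\<close>)

definition pullback_mass :: "(real \<Rightarrow> real) \<Rightarrow> nat \<Rightarrow> real set \<Rightarrow> nat \<Rightarrow> real" where
  "pullback_mass \<sigma> n A i = measure lborel {s \<in> A. \<sigma> s \<in> Jint n i}"

context
  fixes \<sigma> :: "real \<Rightarrow> real" and n :: nat
  assumes mp: "mp_bij \<sigma>" and n: "n > 0"
begin

lemma pullback_sets [measurable]:
  assumes [measurable]: "A \<in> sets borel" and A: "A \<subseteq> {0..1}"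
  shows "{s \<in> A. \<sigma> s \<in> Jint n i} \<in> sets borel"
proof -
  have [measurable]: "\<sigma> \<in> measurable (restrict_space lborel {0..1}) (restrict_space lborel {0..1})"
    using mp unfolding mp_bij_def by auto
  have "\<sigma> \<in> borel_measurable (restrict_space lborel {0..1})"
    using mp unfolding mp_bij_def measurable_restrict_space2_iff by auto
  then have "\<sigma> -` Jint n i \<inter> space (restrict_space lborel {0..1}) \<in> sets (restrict_space lborel {0..1})"
    by (rule measurable_sets) (simp add: Jint_def)
  then have "\<sigma> -` Jint n i \<inter> {0..1} \<in> sets borel"
    by (auto simp: sets_restrict_space space_restrict_space)
  then have "A \<inter> (\<sigma> -` Jint n i \<inter> {0..1}) \<in> sets borel" by auto
  also have "A \<inter> (\<sigma> -` Jint n i \<inter> {0..1}) = {s \<in> A. \<sigma> s \<in> Jint n i}" using A by auto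
  finally show ?thesis .
qed

lemma pullback_mass_unit:
  assumes "i < n"
  shows "pullback_mass \<sigma> n {0..1} i = 1 / n"
proof -
  let ?U = "restrict_space lborel {0..1::real}"
  have s: "\<sigma> \<in> measurable ?U ?U" and d: "distr ?U ?U \<sigma> = ?U"
    using mp unfolding mp_bij_def by auto
  have J: "Jint n i \<subseteq> {0..1}" "Jint n i \<in> sets borel" 
    using Jint_subset[OF n assms] by (auto simp: Jint_def)
  then have JU: "Jint n i \<in> sets ?U" by (auto simp: sets_restrict_space image_iff)
  have "emeasure ?U (Jint n i) = emeasure (distr ?U ?U \<sigma>) (Jint n i)" using d by simp
  also have "\<dots> = emeasure ?U (\<sigma> -` Jint n i \<inter> space ?U)" by (rule emeasure_distr[OF s JU])
  also have "\<sigma> -` Jint n i \<inter> space ?U = {s \<in> {0..1}. \<sigma> s \<in> Jint n i}"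
    by (auto simp: space_restrict_space)
  finally have "emeasure lborel (Jint n i) = emeasure lborel {s \<in> {0..1}. \<sigma> s \<in> Jint n i}"
    using J by (subst (asm) (1 2) emeasure_restrict_space) auto
  then have "pullback_mass \<sigma> n {0..1} i = measure lborel (Jint n i)"
    unfolding pullback_mass_def measure_def by simp
  also have "\<dots> = 1 / n" using n by (simp add: Jint_def field_simps)
  finally show ?thesis .
qed

lemma pullback_mass_disjoint_sum:
  assumes R: "finite R" and A: "\<And>a. A a \<in> sets borel" "disjoint_family_on A R"
    "(\<Union>a\<in>R. A a) = {0..1}" and i: "i < n"
  shows "(\<Sum>a\<in>R. pullback_mass \<sigma> n (A a) i) = 1 / n"
proof -
  have sub: "A a \<subseteq> {0..1}" if "a \<in> R" for a using A(3) that by auto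
  have "(\<Sum>a\<in>R. pullback_mass \<sigma> n (A a) i) = measure lborel (\<Union>a\<in>R. {s \<in> A a. \<sigma> s \<in> Jint n i})"
    unfolding pullback_mass_def
  proof (rule measure_finite_Union[symmetric, OF R])
    show "(\<lambda>a. {s \<in> A a. \<sigma> s \<in> Jint n i}) ` R \<subseteq> sets lborel"
      using pullback_sets[OF A(1) sub] by auto
    show "disjoint_family_on (\<lambda>a. {s \<in> A a. \<sigma> s \<in> Jint n i}) R"
      using A(2) unfolding disjoint_family_on_def by blast
    show "emeasure lborel {s \<in> A a. \<sigma> s \<in> Jint n i} \<noteq> \<infinity>" if "a \<in> R" for a
    proof -
      have "{s \<in> A a. \<sigma> s \<in> Jint n i} \<subseteq> {0..1}" using sub[OF that] by auto
      from subset_unit_fmeasurable[OF pullback_sets[OF A(1) sub[OF that]] this]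
      show ?thesis by (auto simp: fmeasurable_def)
    qed
  qed
  also have "(\<Union>a\<in>R. {s \<in> A a. \<sigma> s \<in> Jint n i}) = {s \<in> {0..1}. \<sigma> s \<in> Jint n i}"
    unfolding A(3)[symmetric] by auto
  finally show ?thesis using pullback_mass_unit[OF i] by (simp add: pullback_mass_def)
qed

text \<open>The closed cells overlap at endpoints, so additivity over i is not immediate. Covering
  gives "at least" for A and for its complement in the unit interval; the row sums 1/n make the two
  totals add up to 1, which forces equality in both.\<close>

lemma pullback_mass_total:
  assumes "A \<in> sets borel" "A \<subseteq> {0..1}"
  shows "(\<Sum>i<n. pullback_mass \<sigma> n A i) = measure lborel A"
proof -
  have into: "\<sigma> s \<in> {0..1}" if "s \<in> {0..1}" for s
    using mp that unfolding mp_bij_def bij_betw_def by auto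
  have ge: "measure lborel B \<le> (\<Sum>i<n. pullback_mass \<sigma> n B i)"
    if B: "B \<in> sets borel" "B \<subseteq> {0..1}" for B
  proof -
    have "B = (\<Union>i<n. {s \<in> B. \<sigma> s \<in> Jint n i})"
      using into B Jint_cover[OF n] by fast
    then have "measure lborel B = measure lborel (\<Union>i<n. {s \<in> B. \<sigma> s \<in> Jint n i})" by simp
    also have "\<dots> \<le> (\<Sum>i<n. pullback_mass \<sigma> n B i)"
      unfolding pullback_mass_def
      by (rule measure_UNION_le) (auto intro: pullback_sets[OF B])
    finally show ?thesis .
  qed
  let ?A = "\<lambda>b. if b then A else {0..1} - A"
  have "(\<Sum>b\<in>UNIV. pullback_mass \<sigma> n (?A b) i) = 1 / n" if "i < n" for i
    by (rule pullback_mass_disjoint_sum[OF _ _ _ _ that])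
       (use assms in \<open>auto simp: disjoint_family_on_def UNIV_bool\<close>)
  then have "(\<Sum>i<n. pullback_mass \<sigma> n A i + pullback_mass \<sigma> n ({0..1} - A) i) = (\<Sum>i<n. 1 / n)"
    by (intro sum.cong refl) (auto simp: UNIV_bool add.commute)
  also have "\<dots> = 1" using n by simp
  finally have "(\<Sum>i<n. pullback_mass \<sigma> n A i) + (\<Sum>i<n. pullback_mass \<sigma> n ({0..1} - A) i) = 1"
    by (simp add: sum.distrib)
  moreover have "measure lborel ({0..1} - A) = 1 - measure lborel A"
    using assms by (subst measure_Diff) (auto simp: emeasure_lborel_Icc_eq)
  moreover have "measure lborel ({0..1} - A) \<le> (\<Sum>i<n. pullback_mass \<sigma> n ({0..1} - A) i)"
    using assms by (intro ge) auto
  ultimately show ?thesis using ge[OF assms] by linarith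
qed

text \<open>Cut off to the rectangle, the pulled-back matrix kernel is a combination of indicators
  of product sets. The identity holds at every point, also where closed cells overlap, because both
  sides add the same indicators there.\<close>

lemma rectangle_integral_mat_kernel:
  assumes A: "A \<in> sets borel" "A \<subseteq> {0..1}" and B: "B \<in> sets borel" "B \<subseteq> {0..1}"
  shows "set_integrable lborel (A \<times> B) (act \<sigma> (mat_kernel n x))"
    and "(LINT z:A \<times> B|lborel. act \<sigma> (mat_kernel n x) z)
      = (\<Sum>i<n. \<Sum>j<n. sym_entry x i j * pullback_mass \<sigma> n A i * pullback_mass \<sigma> n B j)"
proof -
  let ?P = "\<lambda>A i. {s \<in> A. \<sigma> s \<in> Jint n i}"
  have eq: "indicator (A \<times> B) z *\<^sub>R act \<sigma> (mat_kernel n x) z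
      = (\<Sum>i<n. \<Sum>j<n. sym_entry x i j * indicator (?P A i \<times> ?P B j) z)" for z
  proof (cases "z \<in> A \<times> B")
    case True
    then show ?thesis
      by (cases z) (auto simp: act_def mat_kernel_def indicator_def intro!: sum.cong split: if_splits)
  next
    case False
    then have "indicator (?P A i \<times> ?P B j) z = (0 :: real)" for i j by (auto simp: indicator_def)
    then show ?thesis using False by simp
  qed
  have em: "emeasure lborel (?P A i \<times> ?P B j)
      = ennreal (pullback_mass \<sigma> n A i) * ennreal (pullback_mass \<sigma> n B j)" for i j
  proof -
    have "emeasure lborel (?P A i \<times> ?P B j) = emeasure lborel (?P A i) * emeasure lborel (?P B j)"
      unfolding lborel_prod[symmetric]
      by (rule lborel.emeasure_pair_measure_Times)
         (use pullback_sets[OF A] pullback_sets[OF B] in auto)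
    moreover have "emeasure lborel (?P A i) = ennreal (pullback_mass \<sigma> n A i)"
      unfolding pullback_mass_def using A
      by (intro emeasure_eq_measure2 subset_unit_fmeasurable pullback_sets) auto
    moreover have "emeasure lborel (?P B j) = ennreal (pullback_mass \<sigma> n B j)"
      unfolding pullback_mass_def using B
      by (intro emeasure_eq_measure2 subset_unit_fmeasurable pullback_sets) auto
    ultimately show ?thesis by simp
  qed
  have me: "?P A i \<times> ?P B j \<in> sets lborel" for i j
    using pullback_sets[OF A] pullback_sets[OF B] by (auto simp: borel_prod[symmetric])
  have int: "integrable lborel (\<lambda>z. sym_entry x i j * indicator (?P A i \<times> ?P B j) z)" for i j
    using me em by (intro integrable_mult_right integrable_real_indicator) (auto simp: ennreal_mult_less_top)
  have val: "(\<integral>z. sym_entry x i j * indicator (?P A i \<times> ?P B j) z \<partial>lborel)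
      = sym_entry x i j * pullback_mass \<sigma> n A i * pullback_mass \<sigma> n B j" for i j
    using em[of i j] me[of i j]
    by (simp add: measure_def enn2real_mult pullback_mass_def)
  show "set_integrable lborel (A \<times> B) (act \<sigma> (mat_kernel n x))"
    unfolding set_integrable_def eq using int by (intro Bochner_Integration.integrable_sum)
  show "(LINT z:A \<times> B|lborel. act \<sigma> (mat_kernel n x) z)
      = (\<Sum>i<n. \<Sum>j<n. sym_entry x i j * pullback_mass \<sigma> n A i * pullback_mass \<sigma> n B j)"
    unfolding set_lebesgue_integral_def eq
    by (simp only: Bochner_Integration.integral_sum Bochner_Integration.integrable_sum int val)
qed

end

text \<open>The cut distance is tested only on the rectangles \<open>A a \<times> A b\<close>. This
  turns closeness into finitely many conditions on the weights p; the bijection does not appear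
  beyond this point.\<close>

lemma cut_delta_less_imp_weights:
  fixes A :: "'a \<Rightarrow> real set"
  assumes f: "f \<in> kernel_space" and n: "n > 0" and lt: "cut_delta (mat_kernel n x) f < \<epsilon>"
    and R: "finite R" and A: "\<And>a. A a \<in> sets borel" "disjoint_family_on A R"
    "(\<Union>a\<in>R. A a) = {0..1}"
  shows "\<exists>p :: nat \<Rightarrow> 'a \<Rightarrow> real. (\<forall>i a. 0 \<le> p i a) \<and> (\<forall>i<n. (\<Sum>a\<in>R. p i a) = 1)
    \<and> (\<forall>a\<in>R. (\<Sum>i<n. p i a) = real n * measure lborel (A a))
    \<and> (\<forall>a\<in>R. \<forall>b\<in>R.
      \<bar>(\<Sum>i<n. \<Sum>j<n. sym_entry x i j * (p i a * p j b)) - (real n)\<^sup>2 * (LINT z:A a \<times> A b|lborel. f z)\<bar>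
        \<le> (real n)\<^sup>2 * \<epsilon>)"
proof -
  \<comment> \<open>The identity makes the infimum in \<open>cut_delta\<close> range over a nonempty
    set, so that a value below \<epsilon> yields an actual bijection.\<close>
  have "mp_bij (\<lambda>s. s)"
    unfolding mp_bij_def by (auto simp: bij_betw_def distr_id)
  then have "{\<sigma>. mp_bij \<sigma>} \<noteq> {}" by auto
  then obtain \<sigma> where mp: "mp_bij \<sigma>" and cd: "cut_dist (act \<sigma> (mat_kernel n x)) f < \<epsilon>"
    using cInf_lessD[of "(\<lambda>\<sigma>. cut_dist (act \<sigma> (mat_kernel n x)) f) ` {\<sigma>. mp_bij \<sigma>}" \<epsilon>] lt
    unfolding cut_delta_def by auto
  \<comment> \<open>The factor n turns cell masses, whose sum over the classes is 1/n, into
    probability vectors.\<close>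
  define p where "p i a = real n * pullback_mass \<sigma> n (A a) i" for i a
  have sub: "A a \<subseteq> {0..1}" if "a \<in> R" for a using A(3) that by auto
  have kD: "set_integrable lborel Dsq (act \<sigma> (mat_kernel n x))"
    unfolding Dsq_def by (rule rectangle_integral_mat_kernel(1)[OF mp n]) auto
  have fD: "set_integrable lborel Dsq f" by (rule kernel_space_set_integrable[OF f])
  have bound: "\<bar>(\<Sum>i<n. \<Sum>j<n. sym_entry x i j * (p i a * p j b)) - (real n)\<^sup>2 * (LINT z:A a \<times> A b|lborel. f z)\<bar>
      \<le> (real n)\<^sup>2 * \<epsilon>" if ab: "a \<in> R" "b \<in> R" for a b
  proof -
    let ?S = "\<Sum>i<n. \<Sum>j<n. sym_entry x i j * pullback_mass \<sigma> n (A a) i * pullback_mass \<sigma> n (A b) j"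
    have mAB: "A a \<times> A b \<in> sets (lborel :: (real \<times> real) measure)"
      using A(1) ab by (auto simp: borel_prod[symmetric])
    have fi: "set_integrable lborel (A a \<times> A b) f"
      by (rule set_integrable_subset[OF fD mAB]) (use sub ab in \<open>auto simp: Dsq_def\<close>)
    have "\<bar>LINT z:A a \<times> A b|lborel. act \<sigma> (mat_kernel n x) z - f z\<bar> \<le> cut_dist (act \<sigma> (mat_kernel n x)) f"
      using kD fD ab A(1) sub by (intro rectangle_integral_le_cut_dist set_integral_diff) auto
    also have "\<dots> \<le> \<epsilon>" using cd by simp
    also have "(LINT z:A a \<times> A b|lborel. act \<sigma> (mat_kernel n x) z - f z)
        = ?S - (LINT z:A a \<times> A b|lborel. f z)"
      using rectangle_integral_mat_kernel[OF mp n A(1) sub[OF ab(1)] A(1) sub[OF ab(2)]] fi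
      by (subst set_integral_diff(2)) auto
    finally have "(real n)\<^sup>2 * \<bar>?S - (LINT z:A a \<times> A b|lborel. f z)\<bar> \<le> (real n)\<^sup>2 * \<epsilon>"
      by (intro mult_left_mono) auto
    moreover have "(\<Sum>i<n. \<Sum>j<n. sym_entry x i j * (p i a * p j b)) = (real n)\<^sup>2 * ?S"
      by (simp add: p_def sum_distrib_left power2_eq_square mult_ac)
    ultimately show ?thesis by (simp add: abs_mult right_diff_distrib[symmetric])
  qed
  show ?thesis
  proof (intro exI[of _ p] conjI allI ballI impI)
    show "0 \<le> p i a" for i a by (simp add: p_def pullback_mass_def)
    show "(\<Sum>a\<in>R. p i a) = 1" if "i < n" for i
      using pullback_mass_disjoint_sum[OF mp n R A that] n
      by (simp add: p_def sum_distrib_left[symmetric])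
    show "(\<Sum>i<n. p i a) = real n * measure lborel (A a)" if "a \<in> R" for a
      using pullback_mass_total[OF mp n A(1) sub[OF that]]
      by (simp add: p_def sum_distrib_left[symmetric])
  qed (rule bound)
qed

section \<open>Exponential bound for cut balls from a fixed step kernel\<close>

text \<open>Folds ordered pairs onto the independent coordinates. The diagonal of
  \<open>idx n\<close> receives the value 0, so the sum runs over the full index set of the product
  measure.\<close>

lemma sum_off_diagonal_idx:
  fixes w :: "nat \<Rightarrow> nat \<Rightarrow> real"
  shows "(\<Sum>i<n. \<Sum>j\<in>{..<n}-{i}. w i j) = (\<Sum>(i, j)\<in>idx n. if i = j then 0 else w i j + w j i)"
proof -
  let ?L = "{(i, j). i < j \<and> j < n}" and ?U = "{(i, j). j < i \<and> i < n}"
  have fin: "finite (idx n)" by (rule finite_subset[of _ "{..<n} \<times> {..<n}"]) (auto simp: idx_def)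
  have finL: "finite ?L" by (rule finite_subset[of _ "{..<n} \<times> {..<n}"]) auto
  have finU: "finite ?U" by (rule finite_subset[of _ "{..<n} \<times> {..<n}"]) auto
  have "(\<Sum>i<n. \<Sum>j\<in>{..<n}-{i}. w i j) = (\<Sum>(i, j)\<in>(SIGMA i:{..<n}. {..<n}-{i}). w i j)"
    by (rule sum.Sigma) auto
  also have "(SIGMA i:{..<n}. {..<n}-{i}) = ?L \<union> ?U" by auto
  also have "(\<Sum>(i, j)\<in>\<dots>. w i j) = (\<Sum>(i, j)\<in>?L. w i j) + (\<Sum>(i, j)\<in>?U. w i j)"
    using finL finU by (intro sum.union_disjoint) auto
  also have "(\<Sum>(i, j)\<in>?U. w i j) = (\<Sum>(i, j)\<in>?L. w j i)"
    by (rule sum.reindex_bij_witness[of _ prod.swap prod.swap]) auto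
  also have "(\<Sum>(i, j)\<in>?L. w i j) + (\<Sum>(i, j)\<in>?L. w j i) = (\<Sum>(i, j)\<in>?L. if i = j then 0 else w i j + w j i)"
    unfolding sum.distrib[symmetric] by (intro sum.cong) auto
  also have "\<dots> = (\<Sum>(i, j)\<in>idx n. if i = j then 0 else w i j + w j i)"
    using fin by (intro sum.mono_neutral_left) (auto simp: idx_def split: if_splits)
  finally show ?thesis .
qed

lemma Limsup_le_of_tendsto:
  fixes u :: "'a \<Rightarrow> real" and g :: "'a \<Rightarrow> ereal"
  assumes "F \<noteq> bot" "eventually (\<lambda>x. g x \<le> ereal (u x)) F" "(u \<longlongrightarrow> c) F"
  shows "Limsup F g \<le> ereal c"
proof -
  have "Limsup F g \<le> Limsup F (\<lambda>x. ereal (u x))" by (rule Limsup_mono) fact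
  also have "\<dots> = ereal c" using assms by (intro lim_imp_Limsup) auto
  finally show ?thesis .
qed

lemma scaled_log_le:
  assumes "n > 0" "0 \<le> p" "p \<le> exp t"
  shows "scaled_log n p \<le> ereal (t / (real n)\<^sup>2)"
proof (cases "p = 0")
  case False
  then have "ln p \<le> t" using assms(2,3) by (metis ln_exp ln_mono order_less_le)
  then show ?thesis using False by (simp add: scaled_log_def divide_right_mono)
qed (simp add: scaled_log_def)

context bounded_law
begin

text \<open>The functional J of the overview, with \<open>cgf\<close> as Lambda.\<close>

definition tilted_mean :: "(real \<times> real \<Rightarrow> real) \<Rightarrow> (real \<times> real \<Rightarrow> real) \<Rightarrow> real" where
  "tilted_mean f \<phi> = (LINT z:Dsq|lborel. \<phi> z * f z - cgf (\<phi> z))"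

lemma tilted_mean_step:
  fixes A :: "'a \<Rightarrow> real set"
  assumes f: "f \<in> kernel_space"
    and R: "finite R" and A: "\<And>a. A a \<in> sets borel" "disjoint_family_on A R"
    "(\<Union>a\<in>R. A a) = {0..1}"
    and \<phi>: "\<forall>a\<in>R. \<forall>b\<in>R. \<forall>s\<in>A a. \<forall>t\<in>A b. \<phi> (s, t) = \<Theta> a b"
  shows "tilted_mean f \<phi> = (\<Sum>a\<in>R. \<Sum>b\<in>R. \<Theta> a b * (LINT z:A a \<times> A b|lborel. f z)
      - cgf (\<Theta> a b) * (measure lborel (A a) * measure lborel (A b)))"
proof -
  have sub: "A a \<subseteq> {0..1}" if "a \<in> R" for a using A(3) that by auto
  have uniq: "a = a'" if "a \<in> R" "a' \<in> R" "s \<in> A a" "s \<in> A a'" for a a' s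
    using A(2) that unfolding disjoint_family_on_def by auto
  define g where "g a b z = \<Theta> a b * (indicator (A a \<times> A b) z *\<^sub>R f z) - cgf (\<Theta> a b) * indicator (A a \<times> A b) z"
    for a b z
  have eq: "indicator Dsq z *\<^sub>R (\<phi> z * f z - cgf (\<phi> z)) = (\<Sum>a\<in>R. \<Sum>b\<in>R. g a b z)" for z
  proof (cases "z \<in> Dsq")
    case True
    obtain s t where z: "z = (s, t)" by (cases z)
    then obtain a b where ab: "a \<in> R" "b \<in> R" "s \<in> A a" "t \<in> A b"
      using True A(3) unfolding Dsq_def by (metis (no_types, lifting) UN_iff mem_Sigma_iff)
    have "(\<Sum>b'\<in>R. g a' b' z) = (if a' = a then g a b z else 0)" if "a' \<in> R" for a'
    proof (cases "a' = a")
      case True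
      have "(\<Sum>b'\<in>R. g a b' z) = (\<Sum>b'\<in>{b}. g a b' z)"
      proof (rule sum.mono_neutral_right)
        show "\<forall>b'\<in>R - {b}. g a b' z = 0"
          using uniq ab z by (auto simp: g_def indicator_def)
      qed (use R ab in auto)
      then show ?thesis using True by simp
    next
      case False
      then have "g a' b' z = 0" for b'
        using uniq[OF that ab(1) _ ab(3)] z by (auto simp: g_def indicator_def)
      then show ?thesis using False by simp
    qed
    then have "(\<Sum>a'\<in>R. \<Sum>b'\<in>R. g a' b' z) = g a b z"
      using R ab by (simp add: sum.delta)
    also have "\<dots> = \<phi> z * f z - cgf (\<phi> z)"
      using ab z \<phi> by (simp add: g_def)
    finally show ?thesis using True by simp
  next
    case False
    then have "z \<notin> A a \<times> A b" if "a \<in> R" "b \<in> R" for a b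
      using sub that unfolding Dsq_def by auto
    then show ?thesis using False by (simp add: g_def)
  qed
  have int: "integrable lborel (g a b)"
    and val: "(\<integral>z. g a b z \<partial>lborel) = \<Theta> a b * (LINT z:A a \<times> A b|lborel. f z)
      - cgf (\<Theta> a b) * (measure lborel (A a) * measure lborel (A b))" if ab: "a \<in> R" "b \<in> R" for a b
  proof -
    have mAB: "A a \<times> A b \<in> sets (lborel :: (real \<times> real) measure)"
      using A(1) ab by (auto simp: borel_prod[symmetric])
    have "set_integrable lborel (A a \<times> A b) f"
      by (rule set_integrable_subset[OF kernel_space_set_integrable[OF f] mAB])
         (use sub ab in \<open>auto simp: Dsq_def\<close>)
    then have i1: "integrable lborel (\<lambda>z. \<Theta> a b * (indicator (A a \<times> A b) z *\<^sub>R f z))"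
      unfolding set_integrable_def by (intro integrable_mult_right)
    have "emeasure lborel (A a \<times> A b) = emeasure lborel (A a) * emeasure lborel (A b)"
      unfolding lborel_prod[symmetric]
      by (rule lborel.emeasure_pair_measure_Times) (use A(1) ab in auto)
    also have "emeasure lborel (A a) = ennreal (measure lborel (A a))"
      using subset_unit_fmeasurable[OF A(1) sub] ab by (intro emeasure_eq_measure2) auto
    also have "emeasure lborel (A b) = ennreal (measure lborel (A b))"
      using subset_unit_fmeasurable[OF A(1) sub] ab by (intro emeasure_eq_measure2) auto
    finally have em: "emeasure lborel (A a \<times> A b) = ennreal (measure lborel (A a)) * ennreal (measure lborel (A b))" .
    have i2: "integrable lborel (\<lambda>z. cgf (\<Theta> a b) * indicator (A a \<times> A b) z)"
      using em mAB by (intro integrable_mult_right integrable_real_indicator) (auto simp: ennreal_mult_less_top)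
    show "integrable lborel (g a b)"
      unfolding g_def using i1 i2 by (rule Bochner_Integration.integrable_diff)
    have "measure lborel (A a \<times> A b) = measure lborel (A a) * measure lborel (A b)"
      using em by (simp add: measure_def[of _ "A a \<times> A b"] enn2real_mult)
    then show "(\<integral>z. g a b z \<partial>lborel) = \<Theta> a b * (LINT z:A a \<times> A b|lborel. f z)
      - cgf (\<Theta> a b) * (measure lborel (A a) * measure lborel (A b))"
      unfolding g_def Bochner_Integration.integral_diff[OF i1 i2]
      using mAB by (simp add: set_lebesgue_integral_def)
  qed
  have "tilted_mean f \<phi> = (\<integral>z. (\<Sum>a\<in>R. \<Sum>b\<in>R. g a b z) \<partial>lborel)"
    unfolding tilted_mean_def set_lebesgue_integral_def eq ..
  also have "\<dots> = (\<Sum>a\<in>R. \<integral>z. (\<Sum>b\<in>R. g a b z) \<partial>lborel)"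
    by (intro Bochner_Integration.integral_sum Bochner_Integration.integrable_sum int)
  also have "\<dots> = (\<Sum>a\<in>R. \<Sum>b\<in>R. \<integral>z. g a b z \<partial>lborel)"
    by (intro sum.cong refl Bochner_Integration.integral_sum int)
  finally show ?thesis by (simp add: val)
qed

text \<open>Closeness to \<open>f\<close> only provides fractional labels \<open>p\<close>; since the off-diagonal part of the
  exponent is affine in each row of \<open>p\<close>, some genuine labelling of the indices does at least as well.\<close>

lemma cut_delta_less_imp_labelling:
  fixes A :: "'a \<Rightarrow> real set"
  assumes f: "f \<in> kernel_space" and n: "n > 0" and lt: "cut_delta (mat_kernel n x) f < \<epsilon>"
    and R: "finite R" and A: "\<And>a. A a \<in> sets borel" "disjoint_family_on A R"
    "(\<Union>a\<in>R. A a) = {0..1}"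
    and \<phi>: "\<forall>a\<in>R. \<forall>b\<in>R. \<forall>s\<in>A a. \<forall>t\<in>A b. \<phi> (s, t) = \<Theta> a b"
    and x: "\<And>i. i < n \<Longrightarrow> \<bar>x (i, i)\<bar> \<le> l"
  shows "\<exists>\<alpha>\<in>{..<n} \<rightarrow>\<^sub>E R. (real n)\<^sup>2 * (tilted_mean f \<phi> - \<epsilon> * (\<Sum>a\<in>R. \<Sum>b\<in>R. \<bar>\<Theta> a b\<bar>))
      - real n * (\<Sum>a\<in>R. \<Sum>b\<in>R. l * \<bar>\<Theta> a b\<bar> + \<bar>cgf (\<Theta> a b)\<bar>)
    \<le> (\<Sum>i<n. \<Sum>j\<in>{..<n}-{i}. sym_entry x i j * \<Theta> (\<alpha> i) (\<alpha> j) - cgf (\<Theta> (\<alpha> i) (\<alpha> j)))"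
proof -
  obtain p where p: "\<forall>i a. 0 \<le> p i a" "\<forall>i<n. (\<Sum>a\<in>R. p i a) = 1"
    "\<forall>a\<in>R. (\<Sum>i<n. p i a) = real n * measure lborel (A a)"
    "\<forall>a\<in>R. \<forall>b\<in>R.
      \<bar>(\<Sum>i<n. \<Sum>j<n. sym_entry x i j * (p i a * p j b)) - (real n)\<^sup>2 * (LINT z:A a \<times> A b|lborel. f z)\<bar>
        \<le> (real n)\<^sup>2 * \<epsilon>"
    using cut_delta_less_imp_weights[OF f n lt R A] by (elim exE conjE)
  note p0 = p(1)[rule_format] and p1 = p(2)[rule_format] and pcol = p(3)[rule_format]
    and pcut = p(4)[rule_format]
  define w where "w i j a b = sym_entry x i j * \<Theta> a b - cgf (\<Theta> a b)" for i j a b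
  \<comment> \<open>\<open>C\<close> will bound each of the n diagonal terms; \<open>T\<close>
    collects the losses of size \<epsilon> over the blocks.\<close>
  define C where "C = (\<Sum>a\<in>R. \<Sum>b\<in>R. l * \<bar>\<Theta> a b\<bar> + \<bar>cgf (\<Theta> a b)\<bar>)"
  define T where "T = (\<Sum>a\<in>R. \<Sum>b\<in>R. \<bar>\<Theta> a b\<bar>)"
  define G where "G i j = (\<Sum>a\<in>R. \<Sum>b\<in>R. p i a * p j b * w i j a b)" for i j
  have "(\<Sum>i<n. \<Sum>j<n. G i j) = (\<Sum>a\<in>R. \<Sum>b\<in>R. \<Sum>i<n. \<Sum>j<n. p i a * p j b * w i j a b)"
  proof -
    have "(\<Sum>i<n. \<Sum>j<n. G i j) = (\<Sum>i<n. \<Sum>a\<in>R. \<Sum>j<n. \<Sum>b\<in>R. p i a * p j b * w i j a b)"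
      unfolding G_def by (intro sum.cong refl sum.swap)
    also have "\<dots> = (\<Sum>a\<in>R. \<Sum>i<n. \<Sum>j<n. \<Sum>b\<in>R. p i a * p j b * w i j a b)" by (rule sum.swap)
    also have "\<dots> = (\<Sum>a\<in>R. \<Sum>i<n. \<Sum>b\<in>R. \<Sum>j<n. p i a * p j b * w i j a b)"
      by (intro sum.cong refl sum.swap)
    also have "\<dots> = (\<Sum>a\<in>R. \<Sum>b\<in>R. \<Sum>i<n. \<Sum>j<n. p i a * p j b * w i j a b)"
      by (intro sum.cong refl sum.swap)
    finally show ?thesis .
  qed
  \<comment> \<open>Block by block: the \<open>cgf\<close> part is exact, because the sums of p over
    the indices are prescribed, and the part linear in the entries errs by at most n^2 \<epsilon>
    times \<bar>\<Theta> a b\<bar>.\<close>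
  moreover have "(real n)\<^sup>2 * (\<Theta> a b * (LINT z:A a \<times> A b|lborel. f z)
      - cgf (\<Theta> a b) * (measure lborel (A a) * measure lborel (A b)) - \<epsilon> * \<bar>\<Theta> a b\<bar>)
      \<le> (\<Sum>i<n. \<Sum>j<n. p i a * p j b * w i j a b)" if ab: "a \<in> R" "b \<in> R" for a b
  proof -
    let ?S = "\<Sum>i<n. \<Sum>j<n. sym_entry x i j * (p i a * p j b)"
    have "(\<Sum>i<n. \<Sum>j<n. p i a * p j b) = (\<Sum>i<n. p i a) * (\<Sum>j<n. p j b)"
      by (simp add: sum_product)
    also have "\<dots> = (real n)\<^sup>2 * (measure lborel (A a) * measure lborel (A b))"
      using pcol ab by (simp add: power2_eq_square)
    finally have pp: "(\<Sum>i<n. \<Sum>j<n. p i a * p j b) = (real n)\<^sup>2 * (measure lborel (A a) * measure lborel (A b))" .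
    have "(\<Sum>i<n. \<Sum>j<n. p i a * p j b * w i j a b)
        = (\<Sum>i<n. \<Sum>j<n. \<Theta> a b * (sym_entry x i j * (p i a * p j b)) - cgf (\<Theta> a b) * (p i a * p j b))"
      by (intro sum.cong refl) (simp add: w_def algebra_simps)
    also have "\<dots> = \<Theta> a b * ?S - cgf (\<Theta> a b) * (\<Sum>i<n. \<Sum>j<n. p i a * p j b)"
      by (simp only: sum_subtractf sum_distrib_left)
    finally have e: "(\<Sum>i<n. \<Sum>j<n. p i a * p j b * w i j a b)
        = \<Theta> a b * ?S - cgf (\<Theta> a b) * ((real n)\<^sup>2 * (measure lborel (A a) * measure lborel (A b)))"
      using pp by simp
    have "\<bar>\<Theta> a b * (?S - (real n)\<^sup>2 * (LINT z:A a \<times> A b|lborel. f z))\<bar> \<le> \<bar>\<Theta> a b\<bar> * ((real n)\<^sup>2 * \<epsilon>)"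
      unfolding abs_mult using pcut[OF ab] by (intro mult_left_mono) auto
    then have "\<Theta> a b * ?S \<ge> \<Theta> a b * ((real n)\<^sup>2 * (LINT z:A a \<times> A b|lborel. f z)) - \<bar>\<Theta> a b\<bar> * ((real n)\<^sup>2 * \<epsilon>)"
      unfolding right_diff_distrib by linarith
    then show ?thesis unfolding e by (simp add: algebra_simps)
  qed
  then have "(\<Sum>a\<in>R. \<Sum>b\<in>R. (real n)\<^sup>2 * (\<Theta> a b * (LINT z:A a \<times> A b|lborel. f z)
      - cgf (\<Theta> a b) * (measure lborel (A a) * measure lborel (A b)) - \<epsilon> * \<bar>\<Theta> a b\<bar>))
      \<le> (\<Sum>a\<in>R. \<Sum>b\<in>R. \<Sum>i<n. \<Sum>j<n. p i a * p j b * w i j a b)"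
    by (intro sum_mono)
  moreover have "(\<Sum>a\<in>R. \<Sum>b\<in>R. (real n)\<^sup>2 * (\<Theta> a b * (LINT z:A a \<times> A b|lborel. f z)
      - cgf (\<Theta> a b) * (measure lborel (A a) * measure lborel (A b)) - \<epsilon> * \<bar>\<Theta> a b\<bar>))
      = (real n)\<^sup>2 * (tilted_mean f \<phi> - \<epsilon> * T)"
    unfolding tilted_mean_step[OF f R A \<phi>] T_def
    by (simp only: sum_distrib_left sum_subtractf right_diff_distrib)
  ultimately have total: "(real n)\<^sup>2 * (tilted_mean f \<phi> - \<epsilon> * T) \<le> (\<Sum>i<n. \<Sum>j<n. G i j)" by simp
  \<comment> \<open>A diagonal term is quadratic in its row and cannot be rounded. Weights at most 1
    and the bound l on the diagonal entries keep it below a constant independent of n.\<close>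
  have diag: "G i i \<le> C" if "i < n" for i
  proof -
    have ple: "p i a \<le> 1" if "a \<in> R" for a
      using member_le_sum[of a R "p i"] p1[OF \<open>i < n\<close>] p0 R that by simp
    have "p i a * p i b * w i i a b \<le> l * \<bar>\<Theta> a b\<bar> + \<bar>cgf (\<Theta> a b)\<bar>" if "a \<in> R" "b \<in> R" for a b
    proof -
      have "p i a * p i b * w i i a b \<le> p i a * p i b * \<bar>w i i a b\<bar>"
        using p0 by (intro mult_left_mono) auto
      also have "\<dots> \<le> 1 * 1 * \<bar>w i i a b\<bar>"
        using p0 ple that by (intro mult_right_mono mult_mono) auto
      also have "\<bar>w i i a b\<bar> \<le> \<bar>x (i, i)\<bar> * \<bar>\<Theta> a b\<bar> + \<bar>cgf (\<Theta> a b)\<bar>"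
        unfolding w_def sym_entry_def abs_mult[symmetric] by simp
      also have "\<dots> \<le> l * \<bar>\<Theta> a b\<bar> + \<bar>cgf (\<Theta> a b)\<bar>"
        using x[OF \<open>i < n\<close>] by (intro add_right_mono mult_right_mono) auto
      finally show ?thesis by simp
    qed
    then show ?thesis unfolding G_def C_def by (intro sum_mono)
  qed
  have "(\<Sum>i<n. \<Sum>j<n. G i j) = (\<Sum>i<n. G i i + (\<Sum>j\<in>{..<n}-{i}. G i j))"
    by (intro sum.cong refl sum.remove) auto
  also have "\<dots> \<le> (\<Sum>i<n. C) + (\<Sum>i<n. \<Sum>j\<in>{..<n}-{i}. G i j)"
    unfolding sum.distrib using diag by (intro add_right_mono sum_mono) auto
  finally have "(real n)\<^sup>2 * (tilted_mean f \<phi> - \<epsilon> * T) - real n * C \<le> (\<Sum>i<n. \<Sum>j\<in>{..<n}-{i}. G i j)"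
    using total by simp
  moreover obtain \<alpha> where "\<alpha> \<in> {..<n} \<rightarrow>\<^sub>E R"
    "(\<Sum>i<n. \<Sum>j\<in>{..<n}-{i}. G i j) \<le> (\<Sum>i<n. \<Sum>j\<in>{..<n}-{i}. w i j (\<alpha> i) (\<alpha> j))"
    using exists_labelling_ge_average[OF R, of n p w] p0 p1 unfolding G_def by auto
  ultimately show ?thesis unfolding T_def C_def w_def by (meson order_trans)
qed

text \<open>Each independent entry off the diagonal serves the positions (i, j) and (j, i). Grouping
  them makes the sum equal to twice a sum over \<open>idx n\<close> of averaged tilts, so the
  threshold t becomes t / 2: this is the source of the factor 1/2 in the rate.\<close>

lemma prob_labelling_le:
  "measure (matrix_law \<mu> n) {x \<in> space (matrix_law \<mu> n).
      t \<le> (\<Sum>i<n. \<Sum>j\<in>{..<n}-{i}. sym_entry x i j * \<theta> i j - cgf (\<theta> i j))} \<le> exp (- (t / 2))"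
  and labelling_event_sets:
  "{x \<in> space (matrix_law \<mu> n).
      t \<le> (\<Sum>i<n. \<Sum>j\<in>{..<n}-{i}. sym_entry x i j * \<theta> i j - cgf (\<theta> i j))} \<in> sets (matrix_law \<mu> n)"
proof -
  define h where "h e u = (if fst e = snd e then 0 else
    ((\<theta> (fst e) (snd e) * u - cgf (\<theta> (fst e) (snd e))) + (\<theta> (snd e) (fst e) * u - cgf (\<theta> (snd e) (fst e)))) / 2)"
    for e u
  have fin: "finite (idx n)" by (rule finite_subset[of _ "{..<n} \<times> {..<n}"]) (auto simp: idx_def)
  have eq: "(\<Sum>i<n. \<Sum>j\<in>{..<n}-{i}. sym_entry x i j * \<theta> i j - cgf (\<theta> i j)) = 2 * (\<Sum>e\<in>idx n. h e (x e))" for x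
    unfolding sum_off_diagonal_idx sum_distrib_left
    by (intro sum.cong refl) (auto simp: h_def idx_def sym_entry_def min_def max_def field_simps)
  have [measurable]: "h e \<in> borel_measurable \<mu>" for e unfolding h_def by measurable
  have ev: "{x \<in> space (matrix_law \<mu> n).
      t \<le> (\<Sum>i<n. \<Sum>j\<in>{..<n}-{i}. sym_entry x i j * \<theta> i j - cgf (\<theta> i j))}
    = {x \<in> space (PiM (idx n) (\<lambda>_. \<mu>)). t / 2 \<le> (\<Sum>e\<in>idx n. h e (x e))}"
    unfolding eq matrix_law_def by auto
  show "measure (matrix_law \<mu> n) {x \<in> space (matrix_law \<mu> n).
      t \<le> (\<Sum>i<n. \<Sum>j\<in>{..<n}-{i}. sym_entry x i j * \<theta> i j - cgf (\<theta> i j))} \<le> exp (- (t / 2))"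
    unfolding ev unfolding matrix_law_def
  proof (rule chernoff_PiM[OF fin])
    show "integrable \<mu> (\<lambda>u. exp (h e u))" for e
      unfolding h_def using integrable_exp_mean_tilt by (cases "fst e = snd e") auto
    show "(\<integral>u. exp (h e u) \<partial>\<mu>) \<le> 1" for e
      unfolding h_def using integral_exp_mean_tilt prob_space by (cases "fst e = snd e") auto
  qed measurable
  show "{x \<in> space (matrix_law \<mu> n).
      t \<le> (\<Sum>i<n. \<Sum>j\<in>{..<n}-{i}. sym_entry x i j * \<theta> i j - cgf (\<theta> i j))} \<in> sets (matrix_law \<mu> n)"
    unfolding ev unfolding matrix_law_def by measurable
qed

lemma prob_cut_ball_le:
  fixes A :: "'a \<Rightarrow> real set"
  assumes f: "f \<in> kernel_space" and n: "n > 0"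
    and R: "finite R" and A: "\<And>a. A a \<in> sets borel" "disjoint_family_on A R"
    "(\<Union>a\<in>R. A a) = {0..1}"
    and \<phi>: "\<forall>a\<in>R. \<forall>b\<in>R. \<forall>s\<in>A a. \<forall>t\<in>A b. \<phi> (s, t) = \<Theta> a b"
  shows "measure (matrix_law \<mu> n) {x \<in> space (matrix_law \<mu> n). cut_delta (mat_kernel n x) f < \<epsilon>}
    \<le> real (card R) ^ n *
      exp (- (((real n)\<^sup>2 * (tilted_mean f \<phi> - \<epsilon> * (\<Sum>a\<in>R. \<Sum>b\<in>R. \<bar>\<Theta> a b\<bar>))
        - real n * (\<Sum>a\<in>R. \<Sum>b\<in>R. l * \<bar>\<Theta> a b\<bar> + \<bar>cgf (\<Theta> a b)\<bar>)) / 2))"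
    (is "measure ?M ?E \<le> _ * exp (- (?t / 2))")
proof -
  interpret M: prob_space ?M
    unfolding matrix_law_def by (intro prob_space_PiM prob_space_axioms)
  let ?F = "\<lambda>\<alpha>. {x \<in> space ?M. ?t \<le> (\<Sum>i<n. \<Sum>j\<in>{..<n}-{i}.
      sym_entry x i j * \<Theta> (\<alpha> i) (\<alpha> j) - cgf (\<Theta> (\<alpha> i) (\<alpha> j)))}"
  have Fs: "?F \<alpha> \<in> sets ?M" for \<alpha> by (rule labelling_event_sets)
  have fin: "finite ({..<n} \<rightarrow>\<^sub>E R)" using R by (intro finite_PiE) auto
  \<comment> \<open>The entries are bounded only almost surely, so the labelling events cover the
    cut ball up to a null set.\<close>
  have "AE x in ?M. \<forall>i<n. \<bar>x (i, i)\<bar> \<le> l"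
  proof -
    have "AE x in ?M. \<bar>x (i, i)\<bar> \<le> l" if "i < n" for i
      unfolding matrix_law_def
      by (rule AE_PiM_component) (use that AE_bounded prob_space_axioms in \<open>auto simp: idx_def\<close>)
    then have "AE x in ?M. \<forall>i\<in>{..<n}. \<bar>x (i, i)\<bar> \<le> l" by (intro AE_finite_allI) auto
    then show ?thesis by (simp only: Ball_def lessThan_iff)
  qed
  then have "AE x in ?M. x \<in> ?E \<longrightarrow> x \<in> (\<Union>\<alpha>\<in>{..<n} \<rightarrow>\<^sub>E R. ?F \<alpha>)"
  proof eventually_elim
    case (elim x)
    show ?case
    proof
      assume "x \<in> ?E"
      then have "x \<in> space ?M" "cut_delta (mat_kernel n x) f < \<epsilon>" by auto
      then show "x \<in> (\<Union>\<alpha>\<in>{..<n} \<rightarrow>\<^sub>E R. ?F \<alpha>)"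
        using cut_delta_less_imp_labelling[where \<Theta> = \<Theta> and \<phi> = \<phi> and x = x and \<epsilon> = \<epsilon>, OF f n _ R A \<phi>] elim
        by simp
    qed
  qed
  \<comment> \<open>Measurability is checked for the covering set, a finite union of the events
    \<open>?F \<alpha>\<close>; nothing is claimed about that of the cut ball.\<close>
  then have "measure ?M ?E \<le> measure ?M (\<Union>\<alpha>\<in>{..<n} \<rightarrow>\<^sub>E R. ?F \<alpha>)"
    by (rule M.finite_measure_mono_AE) (rule sets.finite_UN[OF fin Fs])
  also have "\<dots> \<le> (\<Sum>\<alpha>\<in>{..<n} \<rightarrow>\<^sub>E R. measure ?M (?F \<alpha>))"
    by (rule measure_UNION_le[OF fin Fs])
  also have "\<dots> \<le> (\<Sum>\<alpha>\<in>{..<n} \<rightarrow>\<^sub>E R. exp (- (?t / 2)))"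
    by (intro sum_mono prob_labelling_le)
  also have "\<dots> = real (card R) ^ n * exp (- (?t / 2))"
    by (simp add: card_PiE)
  finally show ?thesis .
qed

text \<open>With \<phi> and \<epsilon> fixed, the number of labellings and the diagonal contribute
  O(n) to the exponent and vanish after division by n^2. The remaining error, proportional to
  \<epsilon>, vanishes in the outer limit.\<close>

lemma Limsup_cut_ball_le_step:
  assumes f: "f \<in> kernel_space" and \<phi>: "step_kernel \<phi>"
  shows "Limsup (at_right 0) (\<lambda>\<epsilon>::real. Limsup sequentially (\<lambda>n. scaled_log n
      (measure (matrix_law \<mu> n) {x \<in> space (matrix_law \<mu> n). cut_delta (mat_kernel n x) f < \<epsilon>})))
    \<le> ereal (- tilted_mean f \<phi> / 2)"
proof -
  obtain \<alpha> :: "real \<Rightarrow> nat" and \<Theta> where a: "\<alpha> \<in> measurable borel (count_space UNIV)"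
    and fa: "finite (range \<alpha>)" and pa: "\<And>s t. \<phi> (s, t) = \<Theta> (\<alpha> s) (\<alpha> t)"
    using step_kernelE[OF \<phi>] by metis
  \<comment> \<open>The classes are cut down to the unit interval, which they must partition. Labels
    taken only outside it give empty classes, which a partition in this sense allows.\<close>
  let ?R = "range \<alpha>" and ?A = "\<lambda>a. {0..1} \<inter> \<alpha> -` {a}"
  have As: "?A a \<in> sets borel" for a using measurable_sets[OF a, of "{a}"] by auto
  define m where "m \<epsilon> n = measure (matrix_law \<mu> n)
    {x \<in> space (matrix_law \<mu> n). cut_delta (mat_kernel n x) f < \<epsilon>}" for \<epsilon> n
  define T where "T = (\<Sum>a\<in>?R. \<Sum>b\<in>?R. \<bar>\<Theta> a b\<bar>)"
  define C where "C = (\<Sum>a\<in>?R. \<Sum>b\<in>?R. l * \<bar>\<Theta> a b\<bar> + \<bar>cgf (\<Theta> a b)\<bar>)"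
  define r where "r = ln (real (card ?R))"
  let ?J = "tilted_mean f \<phi>"
  have r: "real (card ?R) = exp r" using fa by (simp add: r_def card_gt_0_iff)
  have m_le: "m \<epsilon> n \<le> exp (real n * r - ((real n)\<^sup>2 * (?J - \<epsilon> * T) - real n * C) / 2)" if "n > 0" for \<epsilon> n
  proof -
    have "m \<epsilon> n \<le> real (card ?R) ^ n * exp (- (((real n)\<^sup>2 * (?J - \<epsilon> * T) - real n * C) / 2))"
      unfolding m_def T_def C_def
      by (rule prob_cut_ball_le[OF f that fa As]) (auto simp: disjoint_family_on_def pa)
    also have "\<dots> = exp (real n * r - ((real n)\<^sup>2 * (?J - \<epsilon> * T) - real n * C) / 2)"
      unfolding r by (simp add: exp_of_nat_mult[symmetric] exp_add[symmetric])
    finally show ?thesis .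
  qed
  have inner: "Limsup sequentially (\<lambda>n. scaled_log n (m \<epsilon> n)) \<le> ereal (- (?J - \<epsilon> * T) / 2)" for \<epsilon>
  proof (rule Limsup_le_of_tendsto)
    show "eventually (\<lambda>n. scaled_log n (m \<epsilon> n) \<le> ereal ((r + C / 2) / real n - (?J - \<epsilon> * T) / 2)) sequentially"
      using eventually_gt_at_top[of 0]
    proof eventually_elim
      case (elim n)
      have "scaled_log n (m \<epsilon> n)
          \<le> ereal ((real n * r - ((real n)\<^sup>2 * (?J - \<epsilon> * T) - real n * C) / 2) / (real n)\<^sup>2)"
        by (rule scaled_log_le[OF elim _ m_le[OF elim]]) (simp add: m_def)
      also have "(real n * r - ((real n)\<^sup>2 * (?J - \<epsilon> * T) - real n * C) / 2) / (real n)\<^sup>2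
          = (r + C / 2) / real n - (?J - \<epsilon> * T) / 2"
        using elim by (simp add: field_simps power2_eq_square)
      finally show ?case .
    qed
    have "(\<lambda>n. (r + C / 2) / real n - (?J - \<epsilon> * T) / 2) \<longlonglongrightarrow> 0 - (?J - \<epsilon> * T) / 2"
      by (intro tendsto_diff tendsto_const lim_const_over_n)
    then show "(\<lambda>n. (r + C / 2) / real n - (?J - \<epsilon> * T) / 2) \<longlonglongrightarrow> - (?J - \<epsilon> * T) / 2"
      by (simp only: diff_0 minus_divide_left)
  qed simp
  have "Limsup (at_right 0) (\<lambda>\<epsilon>. Limsup sequentially (\<lambda>n. scaled_log n (m \<epsilon> n))) \<le> ereal (- ?J / 2)"
  proof (rule Limsup_le_of_tendsto)
    show "eventually (\<lambda>\<epsilon>. Limsup sequentially (\<lambda>n. scaled_log n (m \<epsilon> n)) \<le> ereal (- (?J - \<epsilon> * T) / 2)) (at_right 0)"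
      using inner by simp
    have "((\<lambda>\<epsilon>. - (?J - \<epsilon> * T) / 2) \<longlongrightarrow> - (?J - 0 * T) / 2) (at_right 0)"
      by (intro tendsto_intros) auto
    then show "((\<lambda>\<epsilon>. - (?J - \<epsilon> * T) / 2) \<longlongrightarrow> - ?J / 2) (at_right 0)" by simp
  qed simp
  then show ?thesis unfolding m_def .
qed

end

section \<open>The rate as a supremum over test kernels\<close>

text \<open>Starting with \<open>0\<close> keeps the approximations of the rate nonnegative.\<close>

definition rat_seq :: "nat \<Rightarrow> real" where
  "rat_seq k = (case k of 0 \<Rightarrow> 0 | Suc m \<Rightarrow> of_rat (from_nat m))"

lemma rat_seq_dense:
  assumes "a < b"
  shows "\<exists>k. a < rat_seq k \<and> rat_seq k < b"
proof -
  obtain q :: rat where q: "a < of_rat q" "of_rat q < b"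
    using of_rat_dense[OF assms] by auto
  then show ?thesis
    by (intro exI[of _ "Suc (to_nat q)"]) (simp add: rat_seq_def)
qed

context bounded_law
begin

text \<open>An optimal parameter among the first N + 1 members of \<open>rat_seq\<close>, all of
  which compete from the start value \<open>rat_seq 0\<close> = 0 on. Recording the maximiser, not
  just the maximum, yields a measurable function with finitely many values, so composing it with f
  gives a test kernel.\<close>

fun best_tilt :: "nat \<Rightarrow> real \<Rightarrow> real" where
  "best_tilt 0 u = 0"
| "best_tilt (Suc N) u = (if best_tilt N u * u - cgf (best_tilt N u) < rat_seq (Suc N) * u - cgf (rat_seq (Suc N))
    then rat_seq (Suc N) else best_tilt N u)"

definition legendre_approx :: "nat \<Rightarrow> real \<Rightarrow> real" where
  "legendre_approx N u = best_tilt N u * u - cgf (best_tilt N u)"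

lemma legendre_approx_Suc:
  "legendre_approx (Suc N) u = max (legendre_approx N u) (rat_seq (Suc N) * u - cgf (rat_seq (Suc N)))"
  by (simp add: legendre_approx_def)

lemma best_tilt_measurable [measurable]: "best_tilt N \<in> borel_measurable borel"
  by (induction N) simp_all

lemma finite_range_best_tilt: "finite (range (best_tilt N))"
proof (induction N)
  case (Suc N)
  have "range (best_tilt (Suc N)) \<subseteq> insert (rat_seq (Suc N)) (range (best_tilt N))" by auto
  then show ?case using Suc finite_subset by blast
qed simp

lemma legendre_approx_measurable [measurable]: "legendre_approx N \<in> borel_measurable borel"
  unfolding legendre_approx_def by measurable

lemma incseq_legendre_approx: "incseq (\<lambda>N. legendre_approx N u)"
  by (rule incseq_SucI) (simp add: legendre_approx_Suc)

lemma legendre_approx_0: "legendre_approx 0 u = 0"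
  by (simp add: legendre_approx_def cgf_0)

lemma legendre_approx_nonneg: "0 \<le> legendre_approx N u"
  using incseqD[OF incseq_legendre_approx, of 0 N u] by (simp add: legendre_approx_0)

lemma legendre_approx_ge: "rat_seq N * u - cgf (rat_seq N) \<le> legendre_approx N u"
  by (cases N) (simp_all add: legendre_approx_0 legendre_approx_Suc cgf_0 rat_seq_def)

text \<open>The exponent is continuous in \<theta>, so rational parameters suffice. The supremum
  over all reals becomes the limit of an increasing sequence of measurable functions, as monotone
  convergence requires.\<close>

lemma rate_h_eq_SUP_legendre_approx: "rate_h \<mu> u = (SUP N. ereal (legendre_approx N u))"
proof (rule antisym)
  have "ereal (\<theta> * u - cgf \<theta>) \<le> (SUP N. ereal (legendre_approx N u))" for \<theta>
  proof (rule ereal_le_epsilon2)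
    fix e :: real assume e: "e > 0"
    \<comment> \<open>As a function of \<theta>, the exponent \<theta> u - \<open>cgf\<close>
      \<theta> is Lipschitz with constant \<bar>u\<bar> + l, so a shift by d costs at most e. The 1
      keeps the denominator positive.\<close>
    define d where "d = e / (\<bar>u\<bar> + l + 1)"
    have d: "d > 0" using e l_nonneg by (simp add: d_def)
    obtain k where k: "\<theta> - d < rat_seq k" "rat_seq k < \<theta> + d"
      using rat_seq_dense[of "\<theta> - d" "\<theta> + d"] d by auto
    let ?q = "rat_seq k"
    have qd: "\<bar>\<theta> - ?q\<bar> \<le> d" using k by linarith
    have "(\<theta> - ?q) * u \<le> \<bar>\<theta> - ?q\<bar> * \<bar>u\<bar>" by (metis abs_ge_self abs_mult)
    also have "\<dots> \<le> d * \<bar>u\<bar>" using qd by (intro mult_right_mono) auto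
    finally have 1: "\<theta> * u - ?q * u \<le> d * \<bar>u\<bar>" by (simp add: algebra_simps)
    have "cgf ?q - cgf \<theta> \<le> l * \<bar>\<theta> - ?q\<bar>" using cgf_lipschitz[of \<theta> ?q] by linarith
    also have "\<dots> \<le> l * d" using qd l_nonneg by (intro mult_left_mono) auto
    finally have 2: "cgf ?q - cgf \<theta> \<le> l * d" .
    have "d * \<bar>u\<bar> + l * d \<le> d * (\<bar>u\<bar> + l + 1)" using d by (simp add: algebra_simps)
    also have "\<dots> = e" using l_nonneg by (simp add: d_def)
    finally have "\<theta> * u - cgf \<theta> \<le> legendre_approx k u + e"
      using 1 2 legendre_approx_ge[of k u] by linarith
    then have "ereal (\<theta> * u - cgf \<theta>) \<le> ereal (legendre_approx k u) + ereal e" by simp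
    also have "\<dots> \<le> (SUP N. ereal (legendre_approx N u)) + ereal e"
      by (intro add_right_mono SUP_upper) auto
    finally show "ereal (\<theta> * u - cgf \<theta>) \<le> (SUP N. ereal (legendre_approx N u)) + ereal e" .
  qed
  then show "rate_h \<mu> u \<le> (SUP N. ereal (legendre_approx N u))"
    unfolding rate_h_def cgf_def by (intro SUP_least) auto
  show "(SUP N. ereal (legendre_approx N u)) \<le> rate_h \<mu> u"
  proof (rule SUP_least)
    fix N
    show "ereal (legendre_approx N u) \<le> rate_h \<mu> u"
      unfolding rate_h_def legendre_approx_def cgf_def by (rule SUP_upper) simp
  qed
qed

lemma e2ennreal_rate_h: "e2ennreal (rate_h \<mu> u) = (SUP N. ennreal (legendre_approx N u))"
proof -
  have "ennreal (legendre_approx N u) = e2ennreal (ereal (legendre_approx N u))" for N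
    by simp
  moreover have "e2ennreal (SUP N. ereal (legendre_approx N u)) = (SUP N. e2ennreal (ereal (legendre_approx N u)))"
    by (rule sup_continuousD[OF sup_continuous_e2ennreal[OF sup_continuous_id], simplified])
       (use incseq_legendre_approx in \<open>auto simp: incseq_def\<close>)
  ultimately show ?thesis by (simp add: rate_h_eq_SUP_legendre_approx)
qed

text \<open>A function with finitely many values is bounded, and \<bar>cgf \<theta>\<bar> \<le> l
  \<bar>\<theta>\<bar>, so a multiple of \<bar>f\<bar> + l on the square dominates.\<close>

lemma integrable_tilted:
  assumes f: "f \<in> kernel_space" and [measurable]: "k \<in> borel_measurable borel" and k: "finite (range k)"
  shows "integrable lborel (\<lambda>z. indicator Dsq z *\<^sub>R (k z * f z - cgf (k z)))"
proof -
  have [measurable]: "(\<lambda>z. indicator Dsq z * f z) \<in> borel_measurable borel"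
    using f unfolding kernel_space_def set_borel_measurable_def by simp
  have gi: "integrable lborel (\<lambda>z. indicator Dsq z * f z)"
    using kernel_space_set_integrable[OF f] unfolding set_integrable_def by simp
  define B where "B = Max (insert 0 (abs ` range k))"
  have B: "\<bar>k z\<bar> \<le> B" for z unfolding B_def using k by (intro Max_ge) auto
  have eq: "indicator Dsq z *\<^sub>R (k z * f z - cgf (k z))
      = k z * (indicator Dsq z * f z) - indicator Dsq z * cgf (k z)" for z by (simp add: indicator_def)
  have "integrable lborel (\<lambda>z. B * (\<bar>indicator Dsq z * f z\<bar> + l * indicator Dsq z))"
    using gi emeasure_Dsq_finite
    by (intro Bochner_Integration.integrable_add integrable_mult_right integrable_abs
        integrable_real_indicator) auto
  then show ?thesis
  proof (rule Bochner_Integration.integrable_bound)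
    show "(\<lambda>z. indicator Dsq z *\<^sub>R (k z * f z - cgf (k z))) \<in> borel_measurable lborel"
      unfolding eq by measurable
    show "AE z in lborel. norm (indicator Dsq z *\<^sub>R (k z * f z - cgf (k z)))
        \<le> norm (B * (\<bar>indicator Dsq z * f z\<bar> + l * indicator Dsq z))"
    proof (rule AE_I2)
      fix z
      have B0: "0 \<le> B" using B[of z] by linarith
      have "\<bar>cgf (k z)\<bar> \<le> l * \<bar>k z\<bar>" using cgf_lipschitz[of "k z" 0] by (simp add: cgf_0)
      also have "\<dots> \<le> l * B" using B l_nonneg by (intro mult_left_mono) auto
      finally have 1: "\<bar>cgf (k z)\<bar> \<le> l * B" .
      have 2: "\<bar>k z * f z\<bar> \<le> B * \<bar>f z\<bar>" unfolding abs_mult using B by (intro mult_right_mono) auto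
      have "\<bar>k z * f z - cgf (k z)\<bar> \<le> B * (\<bar>f z\<bar> + l)"
        using 1 2 unfolding distrib_left by (simp add: mult.commute[of l])
      then show "norm (indicator Dsq z *\<^sub>R (k z * f z - cgf (k z)))
          \<le> norm (B * (\<bar>indicator Dsq z * f z\<bar> + l * indicator Dsq z))"
        using B0 l_nonneg by (cases "z \<in> Dsq") (auto simp: abs_mult)
    qed
  qed
qed

text \<open>When the tilt is chosen pointwise, J becomes the integral of
  \<open>legendre_approx N\<close> along f. These integrands are nonnegative and increase with N, so
  monotone convergence applies even if the rate is infinite.\<close>

lemma rate_I_eq_SUP:
  assumes f: "f \<in> kernel_space"
  shows "rate_I \<mu> f = (SUP N. ennreal (tilted_mean f (\<lambda>z. best_tilt N (indicator Dsq z * f z)) / 2))"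
proof -
  \<comment> \<open>Membership in \<open>kernel_space\<close> gives measurability of f after cutting
    it off outside the square; on the square nothing changes.\<close>
  let ?g = "\<lambda>z. indicator Dsq z * f z"
  have g[measurable]: "?g \<in> borel_measurable borel"
    using f unfolding kernel_space_def set_borel_measurable_def by simp
  define v where "v N z = indicator Dsq z * legendre_approx N (?g z)" for N z
  have vm[measurable]: "v N \<in> borel_measurable borel" for N unfolding v_def by measurable
  have v0: "0 \<le> v N z" for N z unfolding v_def using legendre_approx_nonneg by simp
  have vi: "integrable lborel (v N)" for N
  proof -
    have v_eq: "v N = (\<lambda>z. indicator Dsq z *\<^sub>R (best_tilt N (?g z) * f z - cgf (best_tilt N (?g z))))"
      by (auto simp: v_def legendre_approx_def indicator_def fun_eq_iff)
    show ?thesis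
      unfolding v_eq
    proof (rule integrable_tilted[OF f])
      show "finite (range (\<lambda>z. best_tilt N (?g z)))"
        by (rule finite_subset[OF _ finite_range_best_tilt[of N]]) auto
    qed measurable
  qed
  have tm: "ennreal (tilted_mean f (\<lambda>z. best_tilt N (?g z))) = (\<integral>\<^sup>+z. ennreal (v N z) \<partial>lborel)" for N
  proof -
    have "tilted_mean f (\<lambda>z. best_tilt N (?g z)) = (\<integral>z. v N z \<partial>lborel)"
      unfolding tilted_mean_def set_lebesgue_integral_def v_def legendre_approx_def
      by (intro Bochner_Integration.integral_cong) (auto simp: indicator_def)
    then show ?thesis using nn_integral_eq_integral[OF vi] v0 by simp
  qed
  have "(\<integral>\<^sup>+ z \<in> Dsq. e2ennreal (rate_h \<mu> (f z)) \<partial>lborel) = (\<integral>\<^sup>+z. (SUP N. ennreal (v N z)) \<partial>lborel)"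
    unfolding e2ennreal_rate_h v_def by (intro nn_integral_cong) (auto simp: indicator_def)
  also have "\<dots> = (SUP N. \<integral>\<^sup>+z. ennreal (v N z) \<partial>lborel)"
  proof (rule nn_integral_monotone_convergence_SUP)
    show "incseq (\<lambda>N z. ennreal (v N z))"
      unfolding incseq_def le_fun_def v_def using incseqD[OF incseq_legendre_approx]
      by (auto intro!: ennreal_leI mult_left_mono)
  qed simp
  finally have "rate_I \<mu> f = (SUP N. (1/2) * (\<integral>\<^sup>+z. ennreal (v N z) \<partial>lborel))"
    unfolding rate_I_def by (simp add: SUP_mult_left_ennreal)
  moreover have "(1/2) * ennreal r = ennreal (r / 2)" for r
    by (cases "0 \<le> r") (auto simp: ennreal_divide_numeral[symmetric] ennreal_neg divide_ennreal_def mult.commute)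
  ultimately show ?thesis by (simp add: tm[symmetric])
qed

text \<open>The Lipschitz bound for \<open>cgf\<close> shows that J drops by at most the integral of
  \<bar>\<psi> - \<phi>\<bar> against the weight \<bar>f\<bar> + l on the square. As f may be
  unbounded, closeness in Lebesgue L^1 would not control this; the approximation is made in L^1 of
  the weighted measure, which is finite because f is integrable.\<close>

lemma tilted_mean_approx:
  assumes f: "f \<in> kernel_space" and e: "e > 0"
    and \<psi>: "\<psi> \<in> borel_measurable borel" "finite (range \<psi>)"
  shows "\<exists>\<phi>. step_kernel \<phi> \<and> tilted_mean f \<psi> - e \<le> tilted_mean f \<phi>"
proof -
  have g[measurable]: "(\<lambda>z. indicator Dsq z * f z) \<in> borel_measurable borel"
    using f unfolding kernel_space_def set_borel_measurable_def by simp
  have gi: "integrable lborel (\<lambda>z. indicator Dsq z * f z)"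
    using kernel_space_set_integrable[OF f] unfolding set_integrable_def by simp
  define d where "d z = \<bar>indicator Dsq z * f z\<bar> + l * indicator Dsq z" for z
  have d0: "0 \<le> d z" for z unfolding d_def using l_nonneg by simp
  have dm[measurable]: "d \<in> borel_measurable borel" unfolding d_def by measurable
  have di: "integrable lborel d"
    unfolding d_def using gi emeasure_Dsq_finite
    by (intro Bochner_Integration.integrable_add integrable_mult_right integrable_abs
        integrable_real_indicator) auto
  define M where "M = density lborel (\<lambda>z. ennreal (d z))"
  have sM: "sets M = sets borel" by (simp add: M_def)
  have "emeasure M (space M) = (\<integral>\<^sup>+z. ennreal (d z) \<partial>lborel)"
    unfolding M_def by (simp add: emeasure_density)
  also have "\<dots> < \<infinity>" using di d0 by (simp add: nn_integral_eq_integral)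
  finally have "finite_measure M" by (intro finite_measureI) auto
  then have "L1_approximable M \<psi>" by (intro L1_approximable_finite_range sM \<psi>)
  then obtain \<phi> where p: "step_kernel \<phi>" "L1_dist M \<psi> \<phi> < ennreal e"
    using e unfolding L1_approximable_def by auto
  have [measurable]: "\<phi> \<in> borel_measurable borel" "\<psi> \<in> borel_measurable borel"
    using p step_kernel_measurable \<psi> by auto
  have fr: "finite (range \<phi>)"
  proof -
    obtain \<alpha> :: "real \<Rightarrow> nat" and \<Theta> where "finite (range \<alpha>)" "\<And>s t. \<phi> (s, t) = \<Theta> (\<alpha> s) (\<alpha> t)"
      using step_kernelE[OF p(1)] by metis
    then have "range \<phi> \<subseteq> (\<lambda>(a, b). \<Theta> a b) ` (range \<alpha> \<times> range \<alpha>)"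
      by (intro image_subsetI, clarify) (rule image_eqI[of _ _ "(\<alpha> _, \<alpha> _)"], auto)
    then show ?thesis using \<open>finite (range \<alpha>)\<close> finite_subset by blast
  qed
  define u where "u k z = indicator Dsq z *\<^sub>R (k z * f z - cgf (k z))" for k z
  have ui: "integrable lborel (u \<psi>)" "integrable lborel (u \<phi>)"
    unfolding u_def using integrable_tilted[OF f] \<psi> fr by auto
  have le: "u \<psi> z - u \<phi> z \<le> d z * \<bar>\<psi> z - \<phi> z\<bar>" for z
  proof (cases "z \<in> Dsq")
    case True
    have "(\<psi> z - \<phi> z) * f z \<le> \<bar>\<psi> z - \<phi> z\<bar> * \<bar>f z\<bar>" by (metis abs_ge_self abs_mult)
    moreover have "cgf (\<phi> z) - cgf (\<psi> z) \<le> l * \<bar>\<psi> z - \<phi> z\<bar>"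
      using cgf_lipschitz[of "\<psi> z" "\<phi> z"] by linarith
    ultimately have "(\<psi> z * f z - cgf (\<psi> z)) - (\<phi> z * f z - cgf (\<phi> z)) \<le> (\<bar>f z\<bar> + l) * \<bar>\<psi> z - \<phi> z\<bar>"
      unfolding distrib_right left_diff_distrib by (simp add: mult.commute)
    then show ?thesis using True by (simp add: u_def d_def)
  qed (simp add: u_def d_def)
  have "ennreal (\<integral>z. u \<psi> z - u \<phi> z \<partial>lborel) \<le> (\<integral>\<^sup>+z. ennreal (u \<psi> z - u \<phi> z) \<partial>lborel)"
  proof -
    have i: "integrable lborel (\<lambda>z. u \<psi> z - u \<phi> z)" using ui by (intro Bochner_Integration.integrable_diff)
    \<comment> \<open>The difference may be negative somewhere, where the nonnegative integral reads
      it as 0; the positive part mediates between the two integrals.\<close>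
    then have ip: "integrable lborel (\<lambda>z. max 0 (u \<psi> z - u \<phi> z))" by (intro integrable_max) auto
    have "(\<integral>z. u \<psi> z - u \<phi> z \<partial>lborel) \<le> (\<integral>z. max 0 (u \<psi> z - u \<phi> z) \<partial>lborel)"
      by (intro integral_mono i ip) auto
    then have "ennreal (\<integral>z. u \<psi> z - u \<phi> z \<partial>lborel) \<le> ennreal (\<integral>z. max 0 (u \<psi> z - u \<phi> z) \<partial>lborel)"
      by (rule ennreal_leI)
    also have "\<dots> = (\<integral>\<^sup>+z. ennreal (max 0 (u \<psi> z - u \<phi> z)) \<partial>lborel)"
      using ip by (intro nn_integral_eq_integral[symmetric]) auto
    also have "\<dots> = (\<integral>\<^sup>+z. ennreal (u \<psi> z - u \<phi> z) \<partial>lborel)"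
      by (intro nn_integral_cong) (simp add: max_def ennreal_neg)
    finally show ?thesis .
  qed
  also have "\<dots> \<le> (\<integral>\<^sup>+z. ennreal (d z) * ennreal \<bar>\<psi> z - \<phi> z\<bar> \<partial>lborel)"
    using le d0 by (intro nn_integral_mono) (simp add: ennreal_mult[symmetric] ennreal_leI)
  also have "\<dots> = L1_dist M \<psi> \<phi>"
    unfolding L1_dist_def M_def by (subst nn_integral_density) auto
  also have "\<dots> \<le> ennreal e" using p by simp
  finally have "(\<integral>z. u \<psi> z - u \<phi> z \<partial>lborel) \<le> e"
    using e by (simp add: ennreal_le_iff)
  moreover have "(\<integral>z. u \<psi> z - u \<phi> z \<partial>lborel) = tilted_mean f \<psi> - tilted_mean f \<phi>"
    unfolding Bochner_Integration.integral_diff[OF ui]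
    by (simp only: tilted_mean_def set_lebesgue_integral_def u_def[abs_def])
  ultimately show ?thesis using p by (intro exI[of _ \<phi>]) auto
qed

end

section \<open>Optimising the bound over test kernels\<close>

theorem theorem4p1:
  fixes l :: real and \<mu> :: "real measure" and f :: "real \<times> real \<Rightarrow> real"
  assumes "prob_space \<mu>" and "sets \<mu> = sets borel" and "measure \<mu> {-l..l} = 1"
    and "f \<in> kernel_space"
  shows "Limsup (at_right 0) (\<lambda>\<epsilon>::real. Limsup sequentially (\<lambda>n. scaled_log n
            (measure (matrix_law \<mu> n)
               {x \<in> space (matrix_law \<mu> n). cut_delta (mat_kernel n x) f < \<epsilon>})))
         \<le> - enn2ereal (rate_I \<mu> f)"
    (is "?L \<le> _")
proof -
  interpret prob_space \<mu> by fact
  have "AE x in \<mu>. x \<in> {-l..l}"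
    using assms(2,3) by (subst AE_in_set_eq_1) auto
  then have "AE x in \<mu>. \<bar>x\<bar> \<le> l" by eventually_elim auto
  then interpret bounded_law \<mu> l
    using assms(2) by unfold_locales
  \<comment> \<open>The bound for step kernels extends to finite-valued measurable kernels. It is
    stated for \<open>- ?L\<close> so that a supremum over \<psi> can be taken on the left.\<close>
  have key: "ereal (tilted_mean f \<psi> / 2) \<le> - ?L"
    if "\<psi> \<in> borel_measurable borel" "finite (range \<psi>)" for \<psi>
  proof -
    have "?L \<le> ereal (- tilted_mean f \<psi> / 2) + ereal e" if "e > 0" for e
    proof -
      obtain \<phi> where p: "step_kernel \<phi>" "tilted_mean f \<psi> - e \<le> tilted_mean f \<phi>"
        using tilted_mean_approx[OF assms(4) \<open>e > 0\<close>] \<open>\<psi> \<in> borel_measurable borel\<close> \<open>finite (range \<psi>)\<close> by blast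
      have "?L \<le> ereal (- tilted_mean f \<phi> / 2)" by (rule Limsup_cut_ball_le_step[OF assms(4) p(1)])
      also have "\<dots> \<le> ereal (- tilted_mean f \<psi> / 2) + ereal e" using p(2) \<open>e > 0\<close> by simp
      finally show ?thesis .
    qed
    then have "?L \<le> ereal (- tilted_mean f \<psi> / 2)" by (rule ereal_le_epsilon2)
    then have "- ereal (- tilted_mean f \<psi> / 2) \<le> - ?L" by (simp only: ereal_minus_le_minus)
    then show ?thesis by simp
  qed
  \<comment> \<open>The zero kernel gives \<open>?L\<close> \<le> 0; hence \<open>- ?L\<close> is
    unchanged by the passage to \<open>ennreal\<close> and back, which truncates negative
    values.\<close>
  have "ereal (tilted_mean f (\<lambda>_. 0) / 2) \<le> - ?L" by (rule key) auto
  moreover have "tilted_mean f (\<lambda>_. 0) = 0"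
    by (simp add: tilted_mean_def cgf_0 set_lebesgue_integral_def)
  ultimately have L0: "0 \<le> - ?L" by (simp only: div_0 zero_ereal_def[symmetric])
  have [measurable]: "(\<lambda>z. indicator Dsq z * f z) \<in> borel_measurable borel"
    using assms(4) unfolding kernel_space_def set_borel_measurable_def by simp
  have "rate_I \<mu> f \<le> e2ennreal (- ?L)"
    unfolding rate_I_eq_SUP[OF assms(4)]
  proof (rule SUP_least)
    fix N
    let ?\<psi> = "\<lambda>z. best_tilt N (indicator Dsq z * f z)"
    have "finite (range ?\<psi>)" by (rule finite_subset[OF _ finite_range_best_tilt[of N]]) auto
    then have "ereal (tilted_mean f ?\<psi> / 2) \<le> - ?L" by (intro key) auto
    from e2ennreal_mono[OF this] show "ennreal (tilted_mean f ?\<psi> / 2) \<le> e2ennreal (- ?L)" by simp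
  qed
  then have "enn2ereal (rate_I \<mu> f) \<le> enn2ereal (e2ennreal (- ?L))" by (simp only: less_eq_ennreal.rep_eq)
  also have "\<dots> = - ?L" by (rule enn2ereal_e2ennreal[OF L0])
  finally have "- (- ?L) \<le> - enn2ereal (rate_I \<mu> f)" by (simp only: ereal_minus_le_minus)
  then show ?thesis by (simp only: ereal_uminus_uminus)
qed

end
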